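(* There is an absolute constant $C>0$ such that for every $0<\delta \leq 1/2$ there exists $k = O\left(\frac{\log^{5}(1/\delta)}{\delta^{2}} \right)$ such that, for every covariance matrix $\Sigma$, the Gaussian distribution $\mathcal N(0, \Sigma)$ on $\mathbb{R}^d$ is $k$-certifiably $(C, \delta)$-anti-concentrated.
   Context: Sum-of-squares proofs: a degree-$\ell$ sum-of-squares proof, in indeterminates $v$, of $g(v)\ge 0$ is an identity $g=\sum_j q_j^2$ with polynomials $q_j$ of degree at most $\ell/2$. Certifiable anti-concentration: a zero-mean distribution $\mathcal D$ on $\mathbb{R}^d$ with covariance $\Sigma$ is $2k$-certifiably $(\delta,C\delta)$-anti-concentrated (also written $2k$-certifiably $(C,\delta)$-anti-concentrated) if there is a univariate polynomial $p$ such that (1) for every $x$ in the support of $\mathcal D$ there is a degree-$2k$ sum-of-squares proof, in the vector indeterminate $v\in\mathbb{R}^d$, of $\|v\|_2^{2k-2}\langle x,v\rangle^2+\delta^2p^2(\langle x,v\rangle)\ge \frac{\delta^2\|\Sigma^{1/2}v\|_2^{2k}}{4}$, and (2) there is a degree-$2k$ sum-of-squares proof in $v$ of $\mathbb{E}_{x\sim\mathcal D}\,p^2(\langle x,v\rangle)\le C\delta\|\Sigma^{1/2}v\|_2^{2k}$.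
   Formalization: In the definition, p²(⟨x,v⟩) is homogenised to ‖Σ^{1/2}v‖^{2k} p²(⟨x,v⟩/‖Σ^{1/2}v‖) with deg p ≤ k, and the factor ‖v‖^{2k-2} becomes ‖Σ^{1/2}v‖^{2k-2}; as printed, (1) fails at x = 0 for every Σ ≠ 0. *)

theory Defs
  imports "HOL-Probability.Probability" "HOL-Computational_Algebra.Polynomial"
begin

text \<open>
  The constants and the degree of the certificates must not depend on the dimension \<open>d\<close>, so \<open>d\<close> is
  a natural number bound inside the formula: a vector of \<open>\<real>\<^sup>d\<close> is a function on \<open>nat\<close> of which only
  the coordinates below \<open>d\<close> are used, and a probability distribution on \<open>\<real>\<^sup>d\<close> lives on the product
  sigma-algebra \<open>\<Pi>\<^sub>M i\<in>{..<d}. borel\<close>.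
\<close>

abbreviation Rd :: "nat \<Rightarrow> (nat \<Rightarrow> real) measure" where
  "Rd d \<equiv> (\<Pi>\<^sub>M i\<in>{..<d}. (borel :: real measure))"

definition inner_d :: "nat \<Rightarrow> (nat \<Rightarrow> real) \<Rightarrow> (nat \<Rightarrow> real) \<Rightarrow> real" where
  "inner_d d x v = (\<Sum>i<d. x i * v i)"

abbreviation norm_d :: "nat \<Rightarrow> (nat \<Rightarrow> real) \<Rightarrow> real" where
  "norm_d d v \<equiv> L2_set v {..<d}"

definition matvec :: "nat \<Rightarrow> (nat \<Rightarrow> nat \<Rightarrow> real) \<Rightarrow> (nat \<Rightarrow> real) \<Rightarrow> nat \<Rightarrow> real" where
  "matvec d A v = (\<lambda>i. \<Sum>j<d. A i j * v j)"

definition psd :: "nat \<Rightarrow> (nat \<Rightarrow> nat \<Rightarrow> real) \<Rightarrow> bool" where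
  "psd d A \<longleftrightarrow> (\<forall>i<d. \<forall>j<d. A i j = A j i) \<and> (\<forall>v. 0 \<le> inner_d d v (matvec d A v))"

text \<open>
  The positive semidefinite square root; its entries with indices below \<open>d\<close> are uniquely determined.
\<close>

definition psd_sqrt :: "nat \<Rightarrow> (nat \<Rightarrow> nat \<Rightarrow> real) \<Rightarrow> nat \<Rightarrow> nat \<Rightarrow> real" where
  "psd_sqrt d A = (SOME B. psd d B \<and> (\<forall>i<d. \<forall>j<d. (\<Sum>l<d. B i l * B l j) = A i j))"

text \<open>
  \<open>\<N>(0, \<Sigma>)\<close> as the law of \<open>\<Sigma>\<^bsup>1/2\<^esup> g\<close> with \<open>g\<close> standard Gaussian, so that singular \<open>\<Sigma>\<close> are covered.
\<close>

definition gaussian :: "nat \<Rightarrow> (nat \<Rightarrow> nat \<Rightarrow> real) \<Rightarrow> (nat \<Rightarrow> real) measure" where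
  "gaussian d \<Sigma> =
     distr (\<Pi>\<^sub>M i\<in>{..<d}. density lborel std_normal_density) (Rd d)
       (\<lambda>g. restrict (matvec d (psd_sqrt d \<Sigma>) g) {..<d})"

definition zero_mean :: "nat \<Rightarrow> (nat \<Rightarrow> real) measure \<Rightarrow> bool" where
  "zero_mean d D \<longleftrightarrow> (\<forall>i<d. integrable D (\<lambda>x. x i) \<and> (LINT x|D. x i) = 0)"

definition has_covariance ::
    "nat \<Rightarrow> (nat \<Rightarrow> real) measure \<Rightarrow> (nat \<Rightarrow> nat \<Rightarrow> real) \<Rightarrow> bool" where
  "has_covariance d D \<Sigma> \<longleftrightarrow>
     (\<forall>i<d. \<forall>j<d.
        integrable D (\<lambda>x. (x i - (LINT y|D. y i)) * (x j - (LINT y|D. y j))) \<and>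
        (LINT x|D. (x i - (LINT y|D. y i)) * (x j - (LINT y|D. y j))) = \<Sigma> i j)"

definition dist_support :: "nat \<Rightarrow> (nat \<Rightarrow> real) measure \<Rightarrow> (nat \<Rightarrow> real) set" where
  "dist_support d D =
     {x \<in> space D. \<forall>\<epsilon>>0. 0 < measure D {y \<in> space D. norm_d d (\<lambda>i. y i - x i) < \<epsilon>}}"

text \<open>
  Polynomials in \<open>v\<^sub>0, \<dots>, v\<^bsub>d-1\<^esub>\<close> are represented by their values; over the reals an identity
  between polynomial functions is the same as an identity of polynomials.
\<close>

definition polyfun_deg_le :: "nat \<Rightarrow> nat \<Rightarrow> ((nat \<Rightarrow> real) \<Rightarrow> real) \<Rightarrow> bool" where
  "polyfun_deg_le d m f \<longleftrightarrow>
     (\<exists>A c. finite A \<and> (\<forall>\<alpha>\<in>A. (\<Sum>i<d. \<alpha> i) \<le> m) \<and>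
        (\<forall>v. f v = (\<Sum>\<alpha>\<in>A. c \<alpha> * (\<Prod>i<d. v i ^ (\<alpha> i :: nat)))))"

definition sos_proof_nonneg :: "nat \<Rightarrow> nat \<Rightarrow> ((nat \<Rightarrow> real) \<Rightarrow> real) \<Rightarrow> bool" where
  "sos_proof_nonneg d l g \<longleftrightarrow>
     (\<exists>qs. (\<forall>q\<in>set qs. polyfun_deg_le d (l div 2) q) \<and> (\<forall>v. g v = (\<Sum>q\<leftarrow>qs. (q v)\<^sup>2)))"

definition sos_proof_ge ::
    "nat \<Rightarrow> nat \<Rightarrow> ((nat \<Rightarrow> real) \<Rightarrow> real) \<Rightarrow> ((nat \<Rightarrow> real) \<Rightarrow> real) \<Rightarrow> bool" where
  "sos_proof_ge d l f g \<longleftrightarrow> sos_proof_nonneg d l (\<lambda>v. f v - g v)"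

text \<open>
  \<open>homog_eval k p s t\<close> is \<open>s\<^sup>k p(t/s)\<close> for \<open>degree p \<le> k\<close>, and equals \<open>p(t)\<close> for \<open>s = 1\<close>.
\<close>

definition homog_eval :: "nat \<Rightarrow> real poly \<Rightarrow> real \<Rightarrow> real \<Rightarrow> real" where
  "homog_eval k p s t = (\<Sum>i\<le>k. coeff p i * t ^ i * s ^ (k - i))"

text \<open>
  The two inequalities are the homogenisations, of degree \<open>2k\<close> in \<open>v\<close>, of
  \<open>\<langle>x,v\<rangle>\<^sup>2 + \<delta>\<^sup>2 p\<^sup>2(\<langle>x,v\<rangle>) \<ge> \<delta>\<^sup>2/4\<close> and \<open>E p\<^sup>2(\<langle>x,v\<rangle>) \<le> C \<delta>\<close> under the normalisation
  \<open>\<parallel>\<Sigma>\<^bsup>1/2\<^esup> v\<parallel> = 1\<close>.  They are often written with \<open>p(\<langle>x,v\<rangle>)\<close> not homogenised and with the factor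
  \<open>\<parallel>v\<parallel>\<^bsup>2k-2\<^esup>\<close> in place of \<open>\<parallel>\<Sigma>\<^bsup>1/2\<^esup> v\<parallel>\<^bsup>2k-2\<^esup>\<close>.  Taken literally that form cannot hold: for \<open>x = 0\<close> the first
  inequality would bound \<open>\<parallel>\<Sigma>\<^bsup>1/2\<^esup> v\<parallel>\<^bsup>2k\<^esup>\<close> by the constant \<open>4 p(0)\<^sup>2\<close>, and with the factor \<open>\<parallel>v\<parallel>\<^bsup>2k-2\<^esup>\<close> the
  notion fails for \<open>\<Sigma> = \<sigma>\<^sup>2 I\<close>, \<open>\<sigma>\<close> large, whenever \<open>C \<delta> < 1/4\<close> and \<open>k \<ge> 2\<close>.  For \<open>\<Sigma> = I\<close> the two factors
  agree.  Integrability is required explicitly because a non-existing Bochner integral is \<open>0\<close>.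
\<close>

definition certifiably_anti_concentrated ::
    "nat \<Rightarrow> nat \<Rightarrow> real \<Rightarrow> real \<Rightarrow> (nat \<Rightarrow> real) measure \<Rightarrow> bool" where
  "certifiably_anti_concentrated d n C \<delta> D \<longleftrightarrow>
     prob_space D \<and> sets D = sets (Rd d) \<and> zero_mean d D \<and>
     (\<exists>k \<Sigma>. n = 2 * k \<and> 1 \<le> k \<and> has_covariance d D \<Sigma> \<and>
       (\<exists>p. degree p \<le> k \<and>
         (\<forall>x\<in>dist_support d D.
            sos_proof_ge d (2 * k)
              (\<lambda>v. norm_d d (matvec d (psd_sqrt d \<Sigma>) v) ^ (2 * k - 2) * (inner_d d x v)\<^sup>2
                 + \<delta>\<^sup>2 * (homog_eval k p (norm_d d (matvec d (psd_sqrt d \<Sigma>) v)) (inner_d d x v))\<^sup>2)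
              (\<lambda>v. \<delta>\<^sup>2 * norm_d d (matvec d (psd_sqrt d \<Sigma>) v) ^ (2 * k) / 4)) \<and>
         (\<forall>v. integrable D
            (\<lambda>x. (homog_eval k p (norm_d d (matvec d (psd_sqrt d \<Sigma>) v)) (inner_d d x v))\<^sup>2)) \<and>
         sos_proof_ge d (2 * k)
           (\<lambda>v. C * \<delta> * norm_d d (matvec d (psd_sqrt d \<Sigma>) v) ^ (2 * k))
           (\<lambda>v. LINT x|D.
              (homog_eval k p (norm_d d (matvec d (psd_sqrt d \<Sigma>) v)) (inner_d d x v))\<^sup>2)))"

end

theory Submission
  imports Defs "HOL-Computational_Algebra.Fundamental_Theorem_Algebra"
begin

text \<open>
  Put \<open>p(t) = \<Sum>\<^sub>i (-1)\<^sup>i (m choose i) t\<^bsup>2i\<^esup> / (2i+1)!!\<close> with \<open>m = \<lceil>1/\<delta>\<^sup>2\<rceil>\<close>.  For standard normal \<open>z\<close> the moments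
  \<open>E p(z) z\<^bsup>2l\<^esup>\<close>, \<open>1 \<le> l \<le> m\<close>, are \<open>m\<close>-th differences of polynomials of degree less than \<open>m\<close>, hence \<open>0\<close>, so
  \<open>E p(z)\<^sup>2 = E p(z) = \<Sum>\<^sub>i (-1)\<^sup>i (m choose i) / (2i+1) \<le> (m+1)\<^bsup>-1/2\<^esup> \<le> \<delta>\<close>.  The alternating sum gives
  \<open>p(t) \<ge> 1 - m t\<^sup>2/3 \<ge> 1/2\<close> for \<open>|t| \<le> \<delta>/2\<close>, so \<open>F(t) = t\<^sup>2 + \<delta>\<^sup>2 p(t)\<^sup>2 - \<delta>\<^sup>2/4\<close> is nonnegative on the whole real line
  and therefore a sum of squares of univariate polynomials, which may be taken even or odd because \<open>F\<close> is even.
  Homogenising with \<open>s = \<parallel>\<Sigma>\<^bsup>1/2\<^esup> v\<parallel>\<close>, the even squares are squares of polynomials in \<open>v\<close>, and the odd ones are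
  \<open>s\<^sup>2\<close>, itself a sum of squares, times such squares.  Thus \<open>C = 1\<close> and degree \<open>O(1/\<delta>\<^sup>2)\<close> suffice.
\<close>

section \<open>Nonnegative univariate polynomials\<close>

lemma map_poly_of_real_add:
  "map_poly complex_of_real (p + q) = map_poly complex_of_real p + map_poly complex_of_real q"
  by (rule poly_eqI) (simp add: coeff_map_poly)

lemma map_poly_of_real_mult:
  "map_poly complex_of_real (p * q) = map_poly complex_of_real p * map_poly complex_of_real q"
  by (rule poly_eqI) (simp add: coeff_map_poly coeff_mult)

text \<open>A complex root \<open>z\<close> exists by the fundamental theorem of algebra. If it is
  not real, its real quadratic \<open>h\<close> divides \<open>q\<close>: the remainder modulo
  \<open>h\<close> has degree at most 1 and vanishes at the nonreal \<open>z\<close>, hence is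
  zero.\<close>

lemma real_poly_factor:
  fixes q :: "real poly"
  assumes "0 < degree q"
  obtains (linear) l r where "q = [:-l, 1:] * r"
    | (quadratic) a b r where "b \<noteq> 0" "q = ([:-a, 1:]\<^sup>2 + [:b\<^sup>2:]) * r"
proof -
  have "\<not> constant (poly (map_poly complex_of_real q))"
    using assms by (simp add: constant_degree degree_map_poly)
  then obtain z where z: "poly (map_poly complex_of_real q) z = 0"
    using fundamental_theorem_of_algebra by blast
  show thesis
  proof (cases "Im z = 0")
    case True
    then have zr: "z = complex_of_real (Re z)" by (simp add: complex_eq_iff)
    have "complex_of_real (poly q (Re z)) = poly (map_poly complex_of_real q) (complex_of_real (Re z))"
      by (simp add: poly_altdef degree_map_poly coeff_map_poly)
    then have "poly q (Re z) = 0" using z zr by simp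
    then show thesis using linear by (metis poly_eq_0_iff_dvd dvdE)
  next
    case False
    define h where "h = [:-Re z, 1:]\<^sup>2 + [:(Im z)\<^sup>2:]"
    have h_eq: "h = [:(Re z)\<^sup>2 + (Im z)\<^sup>2, -2 * Re z, 1:]"
      by (simp add: h_def power2_eq_square)
    define r where "r = q mod h"
    have "h \<noteq> 0" "degree h = 2" by (auto simp: h_eq)
    then have "degree r \<le> 1"
      unfolding r_def using degree_mod_less[of h q] by (cases "q mod h = 0") auto
    then have r: "r = [:coeff r 0, coeff r 1:]"
      by (intro poly_eqI) (auto simp: coeff_pCons coeff_eq_0 split: nat.split)
    have "poly (map_poly complex_of_real h) z = 0"
      by (simp add: h_eq map_poly_pCons complex_eq_iff power2_eq_square algebra_simps)
    moreover have q: "q = q div h * h + r" by (simp add: r_def)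
    moreover have "poly (map_poly complex_of_real (q div h * h + r)) z
        = poly (map_poly complex_of_real (q div h)) z * poly (map_poly complex_of_real h) z
          + poly (map_poly complex_of_real r) z"
      by (simp only: map_poly_of_real_add map_poly_of_real_mult poly_add poly_mult)
    ultimately have "poly (map_poly complex_of_real r) z = 0" using z by simp
    then have "poly (map_poly complex_of_real [:coeff r 0, coeff r 1:]) z = 0" using r by simp
    then have "coeff r 1 = 0" "coeff r 0 = 0" using False
      by (auto simp: map_poly_pCons complex_eq_iff)
    then have "r = 0" using r by simp
    then have "q = h * (q div h)" using q by (simp add: mult.commute)
    then show thesis using quadratic False unfolding h_def by blast
  qed
qed

lemma tendsto_poly_at:
  fixes q :: "real poly"
  shows "(poly q \<longlongrightarrow> poly q l) (at l within S)"
  by (intro tendsto_intros)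

text \<open>Multiplicativity of the norm of \<open>a + b i\<close> and
  \<open>c + d i\<close>.\<close>

lemma sum_two_squares_mult:
  fixes a b c d :: "'a::comm_ring_1"
  shows "(a\<^sup>2 + b\<^sup>2) * (c\<^sup>2 + d\<^sup>2) = (a * c - b * d)\<^sup>2 + (a * d + b * c)\<^sup>2"
  by (simp add: power2_eq_square algebra_simps)

text \<open>Induction on the degree. An irreducible quadratic factor is positive and itself a sum of
  two squares, so the product identity applies; a real root is at least double, so a square splits
  off.\<close>

lemma nonneg_poly_sum_two_squares:
  fixes q :: "real poly"
  assumes "\<And>x. 0 \<le> poly q x"
  shows "\<exists>g h. q = g\<^sup>2 + h\<^sup>2"
  using assms
proof (induction "degree q" arbitrary: q rule: less_induct)
  case less
  show ?case
  proof (cases "degree q = 0")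
    case True
    then obtain c where q: "q = [:c:]" by (metis degree_eq_zeroE)
    then have "0 \<le> c" using less.prems[of 0] by simp
    then have "q = [:sqrt c:]\<^sup>2 + 0\<^sup>2" by (simp add: q power2_eq_square)
    then show ?thesis by blast
  next
    case False
    then have "0 < degree q" by simp
    then show ?thesis
    proof (cases rule: real_poly_factor)
      case (quadratic a b r)
      have "q \<noteq> 0" using False by auto
      then have "r \<noteq> 0" using quadratic by auto
      have deg: "degree ([:-a, 1:]\<^sup>2 + [:b\<^sup>2:]) = 2"
        by (simp add: power2_eq_square)
      have "degree q = 2 + degree r"
        unfolding quadratic by (subst degree_mult_eq) (use \<open>r \<noteq> 0\<close> deg in auto)
      moreover have "0 \<le> poly r x" for x
      proof -
        have "0 < (x - a)\<^sup>2 + b\<^sup>2" using quadratic by (simp add: add_nonneg_pos)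
        moreover have "poly q x = ((x - a)\<^sup>2 + b\<^sup>2) * poly r x"
          by (simp add: quadratic(2))
        ultimately show ?thesis using less.prems[of x] by (metis mult_pos_neg not_less)
      qed
      ultimately obtain g h where "r = g\<^sup>2 + h\<^sup>2" using less.hyps[of r] by auto
      moreover have "[:b\<^sup>2:] = [:b:]\<^sup>2" by (simp add: power2_eq_square)
      ultimately have "q = ([:-a, 1:] * g - [:b:] * h)\<^sup>2 + ([:-a, 1:] * h + [:b:] * g)\<^sup>2"
        using quadratic(2) by (simp only: sum_two_squares_mult)
      then show ?thesis by blast
    next
      case (linear l r)
      have nn: "0 \<le> (x - l) * poly r x" for x
        using less.prems[of x] by (simp add: linear algebra_simps)
      \<comment> \<open>\<open>r\<close> is nonnegative to the right of \<open>l\<close> and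
        nonpositive to the left, so by continuity it vanishes at \<open>l\<close>: the root is at
        least double.\<close>
      have "0 \<le> poly r l"
      proof (rule tendsto_lowerbound)
        show "(poly r \<longlongrightarrow> poly r l) (at_right l)" by (rule tendsto_poly_at)
        have "0 \<le> poly r x" if "l < x" for x
          using nn[of x] that by (metis diff_gt_0_iff_gt mult_pos_neg not_less)
        then show "\<forall>\<^sub>F x in at_right l. 0 \<le> poly r x"
          by (auto simp: eventually_at_filter)
      qed simp
      moreover have "poly r l \<le> 0"
      proof (rule tendsto_upperbound)
        show "(poly r \<longlongrightarrow> poly r l) (at_left l)" by (rule tendsto_poly_at)
        have "poly r x \<le> 0" if "x < l" for x
          using nn[of x] that by (metis diff_less_0_iff_less mult_neg_pos not_less)
        then show "\<forall>\<^sub>F x in at_left l. poly r x \<le> 0"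
          by (auto simp: eventually_at_filter)
      qed simp
      ultimately have "poly r l = 0" by simp
      then obtain r' where r': "r = [:-l, 1:] * r'" by (metis poly_eq_0_iff_dvd dvdE)
      have q: "q = [:-l, 1:]\<^sup>2 * r'" by (simp only: linear r' power2_eq_square mult.assoc)
      have "q \<noteq> 0" using False by auto
      then have "r' \<noteq> 0" using q by auto
      have "degree q = 2 + degree r'"
        unfolding q by (subst degree_mult_eq) (use \<open>r' \<noteq> 0\<close> in \<open>auto simp: degree_power_eq\<close>)
      moreover have off: "0 \<le> poly r' x" if "x \<noteq> l" for x
      proof -
        have "0 < (x - l)\<^sup>2" using that by simp
        moreover have "poly q x = (x - l)\<^sup>2 * poly r' x"
          by (simp add: q)
        ultimately show ?thesis using less.prems[of x] by (metis mult_pos_neg not_less)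
      qed
      \<comment> \<open>At \<open>l\<close> itself the factor \<open>(x - l)^2\<close> is zero and
        gives no sign; continuity does.\<close>
      have "0 \<le> poly r' l"
      proof (rule tendsto_lowerbound)
        show "(poly r' \<longlongrightarrow> poly r' l) (at l)" by (rule tendsto_poly_at)
        show "\<forall>\<^sub>F x in at l. 0 \<le> poly r' x"
          using off by (auto simp: eventually_at_filter intro!: always_eventually)
      qed simp
      with off have "0 \<le> poly r' x" for x by metis
      ultimately obtain g h where "r' = g\<^sup>2 + h\<^sup>2" using less.hyps[of r'] by auto
      then have "q = ([:-l, 1:] * g)\<^sup>2 + ([:-l, 1:] * h)\<^sup>2"
        unfolding q by (simp only: power_mult_distrib distrib_left)
      then show ?thesis by blast
    qed
  qed
qed

text \<open>Leading terms cannot cancel over the reals: with \<open>n\<close> the larger degree, the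
  coefficient at \<open>2 * n\<close> is a sum of two real squares, not both zero.\<close>

lemma degree_le_of_sum_two_squares:
  fixes g h :: "real poly"
  assumes "degree (g\<^sup>2 + h\<^sup>2) \<le> 2 * k"
  shows "degree g \<le> k" and "degree h \<le> k"
proof -
  define n where "n = max (degree g) (degree h)"
  have cf: "coeff (f\<^sup>2) (2 * n) = (coeff f n)\<^sup>2" if "degree f \<le> n" for f :: "real poly"
  proof -
    have "coeff (f * f) (n + n) = (\<Sum>i\<le>n + n. if i = n then coeff f n * coeff f n else 0)"
      unfolding coeff_mult
    proof (rule sum.cong, goal_cases)
      case (2 i)
      then show ?case using that coeff_eq_0[of f i] coeff_eq_0[of f "n + n - i"] by (cases "i < n") auto
    qed simp
    then show ?thesis by (simp add: power2_eq_square mult_2)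
  qed
  have "n \<le> k"
  proof (rule ccontr)
    assume "\<not> n \<le> k"
    then have "degree (g\<^sup>2 + h\<^sup>2) < 2 * n" using assms by linarith
    then have "coeff (g\<^sup>2 + h\<^sup>2) (2 * n) = 0" by (rule coeff_eq_0)
    then have "(coeff g n)\<^sup>2 + (coeff h n)\<^sup>2 = 0"
      using cf[of g] cf[of h] by (simp add: n_def)
    then have "coeff g n = 0" "coeff h n = 0" by (simp_all add: sum_power2_eq_zero_iff)
    \<comment> \<open>The zero polynomial has degree 0 in the formalism; \<open>0 < n\<close>
      ensures that the polynomial of degree \<open>n\<close> has a nonzero leading
      coefficient.\<close>
    moreover have "0 < n" using \<open>\<not> n \<le> k\<close> by simp
    ultimately show False
      unfolding n_def max_def by (metis degree_0 leading_coeff_0_iff less_irrefl)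
  qed
  then show "degree g \<le> k" "degree h \<le> k" by (auto simp: n_def)
qed

section \<open>Polynomials with prescribed values or prescribed roots\<close>

lemma poly_interpolation:
  fixes f :: "'a::field \<Rightarrow> 'a"
  assumes "finite L"
  shows "\<exists>g. \<forall>l\<in>L. poly g l = f l"
  using assms
proof (induction L)
  case (insert a L)
  then obtain g where g: "\<forall>l\<in>L. poly g l = f l" by blast
  \<comment> \<open>Newton interpolation: a multiple of \<open>m\<close> corrects the value at
    \<open>a\<close> without changing those on \<open>L\<close>.\<close>
  define m where "m = (\<Prod>l\<in>L. [:-l, 1:])"
  have "poly m a \<noteq> 0" using insert by (auto simp: m_def poly_prod)
  moreover have "poly m l = 0" if "l \<in> L" for l using insert that by (auto simp: m_def poly_prod)
  ultimately have "\<forall>l\<in>insert a L. poly (g + smult ((f a - poly g a) / poly m a) m) l = f l"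
    using g by simp
  then show ?case by blast
qed simp

text \<open>The roots are distinct, so after dividing by one linear factor the quotient still
  vanishes at all the others.\<close>

lemma prod_linear_factors_dvd:
  fixes q :: "'a::field poly"
  assumes "finite L" "\<And>l. l \<in> L \<Longrightarrow> poly q l = 0"
  shows "(\<Prod>l\<in>L. [:-l, 1:]) dvd q"
  using assms
proof (induction L arbitrary: q)
  case (insert a L)
  then obtain r where r: "q = [:-a, 1:] * r" by (metis poly_eq_0_iff_dvd dvdE insertI1)
  have "poly r l = 0" if "l \<in> L" for l
    using insert.prems[of l] insert.hyps that by (auto simp: r)
  then have "(\<Prod>l\<in>L. [:-l, 1:]) dvd r" by (rule insert.IH)
  then show ?case unfolding r prod.insert[OF insert.hyps] by (intro mult_dvd_mono dvd_refl)
qed simp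

section \<open>The normalised Hermite kernel\<close>

lemma alternating_binomial_Suc:
  fixes f :: "nat \<Rightarrow> real"
  shows "(\<Sum>i\<le>Suc m. (-1)^i * real (Suc m choose i) * f i)
       = (\<Sum>i\<le>m. (-1)^i * real (m choose i) * f i) - (\<Sum>i\<le>m. (-1)^i * real (m choose i) * f (Suc i))"
proof -
  \<comment> \<open>Pascal's rule, after splitting off the term \<open>i = 0\<close>.\<close>
  have "(\<Sum>i\<le>Suc m. (-1)^i * real (Suc m choose i) * f i)
      = f 0 + (\<Sum>i\<le>m. (-1)^Suc i * (real (m choose i) + real (m choose Suc i)) * f (Suc i))"
    by (simp add: sum.atMost_Suc_shift del: sum.atMost_Suc)
  also have "\<dots> = f 0 + (\<Sum>i\<le>m. (-1)^Suc i * real (m choose Suc i) * f (Suc i))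
      - (\<Sum>i\<le>m. (-1)^i * real (m choose i) * f (Suc i))"
    by (simp add: left_diff_distrib distrib_left distrib_right sum.distrib sum_subtractf sum_negf)
  also have "f 0 + (\<Sum>i\<le>m. (-1)^Suc i * real (m choose Suc i) * f (Suc i))
      = (\<Sum>i\<le>Suc m. (-1)^i * real (m choose i) * f i)"
    by (simp add: sum.atMost_Suc_shift del: sum.atMost_Suc)
  finally show ?thesis by simp
qed

text \<open>The summand is a polynomial in \<open>i\<close> of degree \<open>l\<close>, killed by the \<open>m\<close>-th finite difference.\<close>

lemma alternating_binomial_pochhammer:
  fixes a :: real
  assumes "l < m"
  shows "(\<Sum>i\<le>m. (-1)^i * real (m choose i) * pochhammer (a + real i) l) = 0"
  using assms
proof (induction m arbitrary: l a)
  case (Suc m)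
  have "(\<Sum>i\<le>Suc m. (-1)^i * real (Suc m choose i) * pochhammer (a + real i) l)
      = (\<Sum>i\<le>m. (-1)^i * real (m choose i) *
          (pochhammer (a + real i) l - pochhammer (a + real i + 1) l))"
    unfolding alternating_binomial_Suc by (simp add: algebra_simps sum_subtractf)
  also have "\<dots> = 0"
  proof (cases l)
    case (Suc l')
    \<comment> \<open>One difference turns a rising factorial of length \<open>l\<close> into a
      multiple of one of length \<open>l - 1\<close>, so the induction hypothesis applies.\<close>
    have diff: "pochhammer x l - pochhammer (x + 1) l = - real l * pochhammer (x + 1) l'" for x :: real
      unfolding Suc pochhammer_rec[of x] pochhammer_Suc[of "x + 1"] by (simp add: algebra_simps)
    have "(-1)^i * real (m choose i) * (pochhammer (a + real i) l - pochhammer (a + real i + 1) l)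
       = - real l * ((-1)^i * real (m choose i) * pochhammer (a + 1 + real i) l')" for i
      unfolding diff[of "a + real i"] by (simp add: add_ac)
    then have "(\<Sum>i\<le>m. (-1)^i * real (m choose i) *
          (pochhammer (a + real i) l - pochhammer (a + real i + 1) l))
       = - real l * (\<Sum>i\<le>m. (-1)^i * real (m choose i) * pochhammer (a + 1 + real i) l')"
      by (simp only: sum_distrib_left)
    then show ?thesis using Suc.IH[of l' "a + 1"] Suc.prems Suc by simp
  qed simp
  finally show ?case .
qed simp

text \<open>The partial fraction expansion of \<open>m! / (a (a+1) ... (a+m))\<close>. In the
  induction the terms for \<open>a\<close> and \<open>a + 1\<close> share the factors
  \<open>a + 1, ..., a + m\<close>.\<close>

lemma alternating_binomial_inverse:
  fixes a :: real
  assumes "0 < a"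
  shows "(\<Sum>i\<le>m. (-1)^i * real (m choose i) * (1 / (a + real i))) = fact m / pochhammer a (Suc m)"
  using assms
proof (induction m arbitrary: a)
  case (Suc m)
  have "(\<Sum>i\<le>Suc m. (-1)^i * real (Suc m choose i) * (1 / (a + real i)))
      = (\<Sum>i\<le>m. (-1)^i * real (m choose i) * (1 / (a + real i)))
        - (\<Sum>i\<le>m. (-1)^i * real (m choose i) * (1 / ((a + 1) + real i)))"
    unfolding alternating_binomial_Suc by (simp add: add_ac)
  also have "\<dots> = fact m / pochhammer a (Suc m) - fact m / pochhammer (a + 1) (Suc m)"
    using Suc.IH[of a] Suc.IH[of "a + 1"] Suc.prems by simp
  also have "\<dots> = fact (Suc m) / pochhammer a (Suc (Suc m))"
  proof -
    have pos: "0 < pochhammer (a + 1) m" using Suc.prems by (simp add: pochhammer_pos)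
    have "pochhammer a (Suc m) = a * pochhammer (a + 1) m"
      "pochhammer (a + 1) (Suc m) = pochhammer (a + 1) m * (a + 1 + real m)"
      "pochhammer a (Suc (Suc m)) = a * (pochhammer (a + 1) m * (a + 1 + real m))"
      using pochhammer_rec[of a m] pochhammer_Suc[of "a + 1" m] pochhammer_rec[of a "Suc m"] by auto
    moreover have "0 < a + 1 + real m" using Suc.prems by simp
    ultimately show ?thesis using pos Suc.prems by (simp add: divide_simps) (simp add: algebra_simps)
  qed
  finally show ?case .
qed simp

text \<open>The number squared is the product of \<open>2j / (2j+1)\<close> for
  \<open>1 \<le> j \<le> m\<close>; it will turn out to be the second moment of the kernel.\<close>

lemma fact_div_pochhammer_half_le:
  "(fact m / pochhammer (1/2) (Suc m) / 2 :: real)\<^sup>2 \<le> 1 / (real m + 1)"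
proof (induction m)
  case (Suc m)
  define S where "S = (fact m / pochhammer (1/2) (Suc m) / 2 :: real)"
  have pos: "(0::real) < pochhammer (1/2) (Suc m)" by (rule pochhammer_pos) simp
  have "(fact (Suc m) / pochhammer (1/2) (Suc (Suc m)) / 2 :: real) = S * ((2 * real m + 2) / (2 * real m + 3))"
    unfolding S_def pochhammer_Suc[of "1/2" "Suc m"] using pos by (simp add: divide_simps) (simp add: algebra_simps)
  then have "(fact (Suc m) / pochhammer (1/2) (Suc (Suc m)) / 2 :: real)\<^sup>2
      = S\<^sup>2 * ((2 * real m + 2) / (2 * real m + 3))\<^sup>2"
    by (simp only: power_mult_distrib)
  also have "\<dots> \<le> (1 / (real m + 1)) * ((2 * real m + 2) / (2 * real m + 3))\<^sup>2"
    using Suc.IH by (intro mult_right_mono) (auto simp: S_def)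
  \<comment> \<open>Equivalent to \<open>4 (m+1) (m+2) \<le> (2m+3)^2\<close>, where the two sides
    differ by 1.\<close>
  also have "\<dots> \<le> 1 / (real (Suc m) + 1)"
    by (simp add: divide_simps power2_eq_square) (simp add: algebra_simps)
  finally show ?case .
qed simp

text \<open>The Leibniz argument: an alternating sum of decreasing nonnegative terms lies between 0
  and its first term; this is applied to the terms from index 1 on.\<close>

lemma alternating_sum_ge:
  fixes a :: "nat \<Rightarrow> real"
  assumes "\<And>i. 0 \<le> a i" "\<And>i. a (Suc i) \<le> a i" and "1 \<le> m"
  shows "a 0 - a 1 \<le> (\<Sum>i\<le>m. (-1)^i * a i)"
proof -
  have tail: "0 \<le> (\<Sum>i\<le>n. (-1)^i * b i) \<and> (\<Sum>i\<le>n. (-1)^i * b i) \<le> b 0"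
    if "\<And>i. 0 \<le> b i" "\<And>i. b (Suc i) \<le> b i" for b :: "nat \<Rightarrow> real" and n
    using that
  proof (induction n arbitrary: b)
    case (Suc n)
    have "(\<Sum>i\<le>Suc n. (-1)^i * b i) = b 0 - (\<Sum>i\<le>n. (-1)^i * b (Suc i))"
      by (simp add: sum.atMost_Suc_shift sum_negf del: sum.atMost_Suc)
    moreover have "0 \<le> (\<Sum>i\<le>n. (-1)^i * b (Suc i)) \<and> (\<Sum>i\<le>n. (-1)^i * b (Suc i)) \<le> b (Suc 0)"
      by (rule Suc.IH) (use Suc.prems in auto)
    ultimately show ?case using Suc.prems(2)[of 0] by linarith
  qed auto
  obtain n where n: "m = Suc n" using assms(3) by (cases m) auto
  have "(\<Sum>i\<le>m. (-1)^i * a i) = a 0 - (\<Sum>i\<le>n. (-1)^i * a (Suc i))"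
    unfolding n by (simp add: sum.atMost_Suc_shift sum_negf del: sum.atMost_Suc)
  moreover have "(\<Sum>i\<le>n. (-1)^i * a (Suc i)) \<le> a 1" using tail[of "\<lambda>i. a (Suc i)" n] assms by simp
  ultimately show ?thesis by simp
qed

text \<open>
  \<open>hermite_kernel m\<close> is \<open>He\<^bsub>2m+1\<^esub>(t) / (t He'\<^bsub>2m+1\<^esub>(0))\<close>, the reproducing kernel at \<open>0\<close> of the polynomials
  of degree at most \<open>2m\<close> in \<open>L\<^sup>2(N(0,1))\<close>, normalised to the value \<open>1\<close> at \<open>0\<close>.  The denominator
  \<open>2\<^sup>i (3/2)\<^sub>i\<close> is \<open>(2i+1)!!\<close>.
\<close>

definition hermite_kernel_coeff :: "nat \<Rightarrow> nat \<Rightarrow> real" where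
  "hermite_kernel_coeff m i = (-1)^i * real (m choose i) / (2^i * pochhammer (3/2) i)"

definition hermite_kernel :: "nat \<Rightarrow> real poly" where
  "hermite_kernel m = (\<Sum>i\<le>m. monom (hermite_kernel_coeff m i) (2 * i))"

lemma poly_hermite_kernel: "poly (hermite_kernel m) t = (\<Sum>i\<le>m. hermite_kernel_coeff m i * t ^ (2 * i))"
  by (simp add: hermite_kernel_def poly_sum poly_monom)

lemma degree_hermite_kernel: "degree (hermite_kernel m) \<le> 2 * m"
  unfolding hermite_kernel_def
  by (intro degree_sum_le) (auto intro: order.trans[OF degree_monom_le])

lemma coeff_hermite_kernel_odd: "odd n \<Longrightarrow> coeff (hermite_kernel m) n = 0"
  by (auto simp: hermite_kernel_def coeff_sum intro!: sum.neutral)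

text \<open>For such \<open>t\<close> the terms decrease in absolute value, so the sum is at least
  its first two terms, \<open>1 - m t^2 / 3\<close>.\<close>

lemma hermite_kernel_ge_half:
  assumes "1 \<le> m" "real m * t\<^sup>2 \<le> 3/2"
  shows "1/2 \<le> poly (hermite_kernel m) t"
proof -
  define a where "a i = real (m choose i) / (2^i * pochhammer (3/2) i) * t^(2*i)" for i
  have pp: "0 < pochhammer (3/2 :: real) i" for i by (rule pochhammer_pos) simp
  have nn: "0 \<le> a i" for i
    unfolding a_def using pp[of i] by (simp add: zero_le_mult_iff)
  have dec: "a (Suc i) \<le> a i" for i
  proof -
    \<comment> \<open>For \<open>i \<ge> m\<close> the truncated \<open>m - i\<close> is 0, matching
      the vanishing binomial, so the monotonicity holds for every \<open>i\<close>.\<close>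
    have "real (Suc i) * real (m choose Suc i) = real (m - i) * real (m choose i)"
      by (metis binomial_absorb_comp binomial_absorption of_nat_mult mult.commute Suc_times_binomial_eq)
    then have ch: "real (m choose Suc i) = real (m - i) / real (Suc i) * real (m choose i)"
      by (simp add: field_simps)
    have "a (Suc i) = a i * (real (m - i) * t\<^sup>2 / (real (Suc i) * (2 * real i + 3)))"
      unfolding a_def ch pochhammer_Suc using pp[of i]
      by (simp add: divide_simps power2_eq_square)
    also have "\<dots> \<le> a i * 1"
    proof (intro mult_left_mono nn)
      have "real (m - i) * t\<^sup>2 \<le> real m * t\<^sup>2" by (intro mult_right_mono) auto
      also have "\<dots> \<le> real (Suc i) * (2 * real i + 3)"
        using assms(2) mult_mono[of 1 "real (Suc i)" 3 "2 * real i + 3"] by simp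
      finally show "real (m - i) * t\<^sup>2 / (real (Suc i) * (2 * real i + 3)) \<le> 1"
        by (simp add: divide_simps)
    qed
    finally show ?thesis by simp
  qed
  have "poly (hermite_kernel m) t = (\<Sum>i\<le>m. (-1)^i * a i)"
    by (simp add: poly_hermite_kernel hermite_kernel_coeff_def a_def mult.assoc)
  moreover have "a 0 - a 1 \<le> (\<Sum>i\<le>m. (-1)^i * a i)"
    by (rule alternating_sum_ge) (use nn dec assms in auto)
  moreover have "a 0 = 1" "a 1 = real m * t\<^sup>2 / 3" by (auto simp: a_def)
  ultimately show ?thesis using assms by linarith
qed

section \<open>Moments of the kernel under the standard normal law\<close>

lemma gaussian_even_moment: "fact (2 * n) / (2 ^ n * fact n) = 2 ^ n * pochhammer (1/2 :: real) n"
proof (induction n)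
  case (Suc n)
  have f: "fact (2 * Suc n) = (2 * real n + 2) * ((2 * real n + 1) * fact (2 * n))"
    by (simp add: algebra_simps)
  have "fact (2 * Suc n) / (2 ^ Suc n * fact (Suc n)) = (2 * real n + 1) * (fact (2 * n) / (2 ^ n * fact n) :: real)"
    unfolding f by (simp add: divide_simps)
  also have "\<dots> = (2 * real n + 1) * (2 ^ n * pochhammer (1/2) n)" by (simp only: Suc.IH)
  also have "\<dots> = 2 ^ Suc n * pochhammer (1/2) (Suc n)" by (simp add: pochhammer_Suc algebra_simps)
  finally show ?case .
qed simp

lemma std_normal_moment_even':
  "has_bochner_integral lborel (\<lambda>x. std_normal_density x * x ^ (2 * n)) (2 ^ n * pochhammer (1/2 :: real) n)"
  using std_normal_moment_even[of n] by (simp only: gaussian_even_moment)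

text \<open>The sum is \<open>E p(z) z^(2l)\<close> for the kernel \<open>p\<close> and standard
  normal \<open>z\<close>. Cancelling \<open>pochhammer (3/2) i\<close> leaves a multiple of
  \<open>1 / (1/2 + i)\<close> for \<open>l = 0\<close>, and otherwise a polynomial in
  \<open>i\<close> of degree \<open>l - 1 < m\<close>, which the finite difference kills.\<close>

lemma hermite_kernel_moment_sum:
  assumes "l \<le> m"
  shows "(\<Sum>i\<le>m. hermite_kernel_coeff m i * (2 ^ (l + i) * pochhammer (1/2) (l + i)))
    = (if l = 0 then fact m / pochhammer (1/2) (Suc m) / 2 else 0)"
proof -
  have pp: "0 < pochhammer (3/2 :: real) i" for i by (rule pochhammer_pos) simp
  show ?thesis
  proof (cases l)
    case 0
    have "hermite_kernel_coeff m i * (2 ^ i * pochhammer (1/2) i)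
        = (-1)^i * real (m choose i) * (1 / (1/2 + real i)) / 2" for i
    proof -
      have "(1/2) * pochhammer (3/2) i = pochhammer (1/2) i * (1/2 + real i)"
        using pochhammer_rec[of "1/2::real" i] pochhammer_Suc[of "1/2::real" i] by simp
      then have "pochhammer (1/2) i = (1/2) * pochhammer (3/2) i / (1/2 + real i)"
        by (simp add: field_simps add_pos_nonneg)
      then show ?thesis unfolding hermite_kernel_coeff_def using pp[of i] by simp
    qed
    then have "(\<Sum>i\<le>m. hermite_kernel_coeff m i * (2 ^ i * pochhammer (1/2) i))
        = (\<Sum>i\<le>m. (-1)^i * real (m choose i) * (1 / (1/2 + real i))) / 2"
      by (simp only: sum_divide_distrib)
    then show ?thesis using 0 alternating_binomial_inverse[of "1/2" m] by simp
  next
    case (Suc l')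
    have "hermite_kernel_coeff m i * (2 ^ (l + i) * pochhammer (1/2) (l + i))
        = 2 ^ l / 2 * ((-1)^i * real (m choose i) * pochhammer (3/2 + real i) l')" for i
    proof -
      have "pochhammer (1/2 :: real) (l + i) = 1/2 * pochhammer (3/2) (i + l')"
        using pochhammer_rec[of "1/2::real" "i + l'"] by (simp add: Suc add.commute)
      also have "\<dots> = 1/2 * (pochhammer (3/2) i * pochhammer (3/2 + real i) l')"
        by (simp add: pochhammer_product')
      finally have e: "pochhammer (1/2 :: real) (l + i) = 1/2 * (pochhammer (3/2) i * pochhammer (3/2 + real i) l')" .
      show ?thesis unfolding hermite_kernel_coeff_def e using pp[of i] by (simp add: power_add)
    qed
    then show ?thesis using alternating_binomial_pochhammer[of l' m "3/2"] assms Suc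
      by (simp add: sum_distrib_left[symmetric])
  qed
qed

lemma hermite_kernel_second_moment:
  "has_bochner_integral lborel (\<lambda>x. std_normal_density x * (poly (hermite_kernel m) x)\<^sup>2)
    (fact m / pochhammer (1/2) (Suc m) / 2)"
proof -
  define c where "c = hermite_kernel_coeff m"
  have "has_bochner_integral lborel
      (\<lambda>x. \<Sum>l\<le>m. \<Sum>i\<le>m. c l * c i * (std_normal_density x * x ^ (2 * (l + i))))
      (\<Sum>l\<le>m. \<Sum>i\<le>m. c l * c i * (2 ^ (l + i) * pochhammer (1/2) (l + i)))"
    by (intro has_bochner_integral_sum has_bochner_integral_mult_right std_normal_moment_even')
  moreover have "std_normal_density x * (poly (hermite_kernel m) x)\<^sup>2
      = (\<Sum>l\<le>m. \<Sum>i\<le>m. c l * c i * (std_normal_density x * x ^ (2 * (l + i))))" for x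
    by (simp add: poly_hermite_kernel c_def power2_eq_square sum_product sum_distrib_left power_add
        mult_ac distrib_left)
  moreover have "(\<Sum>l\<le>m. \<Sum>i\<le>m. c l * c i * (2 ^ (l + i) * pochhammer (1/2) (l + i)))
      = (\<Sum>l\<le>m. c l * (\<Sum>i\<le>m. c i * (2 ^ (l + i) * pochhammer (1/2) (l + i))))"
    by (simp add: sum_distrib_left mult.assoc)
  \<comment> \<open>Orthogonality to \<open>z^(2l)\<close> for \<open>1 \<le> l \<le> m\<close>:
    only the constant coefficient \<open>c 0 = 1\<close> contributes.\<close>
  moreover have "\<dots> = (\<Sum>l\<le>m. if l = 0 then c 0 * (fact m / pochhammer (1/2) (Suc m) / 2) else 0)"
    unfolding c_def by (intro sum.cong refl) (subst hermite_kernel_moment_sum, auto)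
  moreover have "\<dots> = fact m / pochhammer (1/2) (Suc m) / 2"
    by (simp add: c_def hermite_kernel_coeff_def)
  ultimately show ?thesis by simp
qed

section \<open>Square roots of positive semidefinite matrices\<close>

text \<open>Gaussian elimination: an equation with a nonzero coefficient at \<open>k\<close> is
  solved for that unknown, which is substituted into the others. It serves to find a linear relation
  between powers of a matrix.\<close>

lemma homogeneous_system_nontrivial_solution:
  fixes a :: "'e \<Rightarrow> 'j \<Rightarrow> 'a::field"
  assumes "finite E" "finite J" "card E < card J"
  shows "\<exists>c. (\<exists>j\<in>J. c j \<noteq> 0) \<and> (\<forall>e\<in>E. (\<Sum>j\<in>J. a e j * c j) = 0)"
  using assms
proof (induction E arbitrary: J a)
  case empty
  then obtain j where "j \<in> J" by fastforce
  then show ?case by (intro exI[of _ "\<lambda>_. 1"]) auto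
next
  case (insert e E)
  show ?case
  proof (cases "\<forall>j\<in>J. a e j = 0")
    case True
    have "card E < card J" using insert by simp
    then obtain c where "(\<exists>j\<in>J. c j \<noteq> 0) \<and> (\<forall>e\<in>E. (\<Sum>j\<in>J. a e j * c j) = 0)"
      using insert.IH[of J a] insert.prems by blast
    then show ?thesis using True by (intro exI[of _ c]) simp
  next
    case False
    then obtain k where k: "k \<in> J" "a e k \<noteq> 0" by blast
    define J' where "J' = J - {k}"
    define a' where "a' f j = a f j - a f k * a e j / a e k" for f j
    have J: "J = insert k J'" "k \<notin> J'" "finite J'" using k insert.prems by (auto simp: J'_def)
    have "card E < card J'" using insert J by simp
    then obtain c where c: "\<exists>j\<in>J'. c j \<noteq> 0" "\<forall>f\<in>E. (\<Sum>j\<in>J'. a' f j * c j) = 0"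
      using insert.IH[of J' a'] J by blast
    \<comment> \<open>The value that equation \<open>e\<close> forces on the eliminated
      unknown.\<close>
    define s where "s = - (\<Sum>j\<in>J'. a e j * c j) / a e k"
    define c' where "c' = c(k := s)"
    have sum': "(\<Sum>j\<in>J. a f j * c' j) = a f k * s + (\<Sum>j\<in>J'. a f j * c j)" for f
      using J by (auto simp: c'_def intro!: sum.cong)
    have "(\<Sum>j\<in>J. a e j * c' j) = 0" unfolding sum' s_def using k by simp
    moreover have "(\<Sum>j\<in>J. a f j * c' j) = 0" if "f \<in> E" for f
    proof -
      have "(\<Sum>j\<in>J'. a' f j * c j) = (\<Sum>j\<in>J'. a f j * c j) - a f k / a e k * (\<Sum>j\<in>J'. a e j * c j)"
        by (simp add: a'_def left_diff_distrib sum_subtractf sum_distrib_left mult.assoc)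
      then show ?thesis unfolding sum' s_def using c(2) that by simp
    qed
    moreover have "\<exists>j\<in>J. c' j \<noteq> 0" using c(1) J by (auto simp: c'_def)
    ultimately show ?thesis by blast
  qed
qed

section \<open>Inner products, matrix-vector products and polynomials of a matrix\<close>

lemma inner_d_commute: "inner_d d u v = inner_d d v u"
  by (simp add: inner_d_def mult.commute)

lemma inner_d_add_right: "inner_d d u (\<lambda>i. v i + w i) = inner_d d u v + inner_d d u w"
  by (simp add: inner_d_def distrib_left sum.distrib)

lemma inner_d_add_left: "inner_d d (\<lambda>i. u i + v i) w = inner_d d u w + inner_d d v w"
  by (simp add: inner_d_def distrib_right sum.distrib)

lemma inner_d_scale_right: "inner_d d u (\<lambda>i. c * v i) = c * inner_d d u v"
  by (simp add: inner_d_def sum_distrib_left mult_ac)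

lemma inner_d_self_nonneg: "0 \<le> inner_d d v v"
  by (simp add: inner_d_def sum_nonneg)

lemma inner_d_self_eq_0: "inner_d d v v = 0 \<longleftrightarrow> (\<forall>i<d. v i = 0)"
  by (auto simp: inner_d_def sum_nonneg_eq_0_iff)

lemma inner_d_zero_right: "\<forall>i<d. v i = 0 \<Longrightarrow> inner_d d u v = 0"
  by (simp add: inner_d_def)

lemma matvec_add: "matvec d A (\<lambda>i. v i + w i) = (\<lambda>i. matvec d A v i + matvec d A w i)"
  by (simp add: matvec_def distrib_left sum.distrib)

lemma matvec_scale: "matvec d A (\<lambda>i. c * v i) = (\<lambda>i. c * matvec d A v i)"
  by (simp add: matvec_def sum_distrib_left mult_ac)

lemma matvec_zero: "\<forall>i<d. v i = 0 \<Longrightarrow> matvec d A v = (\<lambda>i. 0)"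
  by (simp add: matvec_def)

text \<open>\<open>poly_matvec d A p v\<close> is \<open>p(A) v\<close>.\<close>

definition poly_matvec :: "nat \<Rightarrow> (nat \<Rightarrow> nat \<Rightarrow> real) \<Rightarrow> real poly \<Rightarrow> (nat \<Rightarrow> real) \<Rightarrow> nat \<Rightarrow> real" where
  "poly_matvec d A p v = fold_coeffs (\<lambda>a u i. a * v i + matvec d A u i) p (\<lambda>i. 0)"

lemma poly_matvec_0: "poly_matvec d A 0 v = (\<lambda>i. 0)"
  by (simp add: poly_matvec_def)

lemma poly_matvec_pCons:
  "poly_matvec d A (pCons a p) v = (\<lambda>i. a * v i + matvec d A (poly_matvec d A p v) i)"
  by (cases "pCons a p = 0")
    (auto simp: poly_matvec_def fold_coeffs_pCons_not_0_0_eq fold_coeffs_pCons_coeff_not_0_eq matvec_zero)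

lemma poly_matvec_1: "poly_matvec d A 1 v = v"
  by (simp add: one_pCons poly_matvec_pCons poly_matvec_0 matvec_zero)

lemma poly_matvec_X: "poly_matvec d A [:a, 1:] v = (\<lambda>i. a * v i + matvec d A v i)"
  by (simp add: poly_matvec_pCons poly_matvec_0 matvec_zero)

lemma poly_matvec_add: "poly_matvec d A (p + q) v = (\<lambda>i. poly_matvec d A p v i + poly_matvec d A q v i)"
  by (induction p q rule: poly_induct2)
    (simp_all add: poly_matvec_pCons poly_matvec_0 matvec_add algebra_simps)

lemma poly_matvec_smult: "poly_matvec d A (smult c p) v = (\<lambda>i. c * poly_matvec d A p v i)"
  by (induction p) (simp_all add: poly_matvec_pCons poly_matvec_0 matvec_scale algebra_simps)

lemma poly_matvec_mult: "poly_matvec d A (p * q) v = poly_matvec d A p (poly_matvec d A q v)"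
  by (induction p)
    (simp_all add: poly_matvec_pCons poly_matvec_0 poly_matvec_add poly_matvec_smult)

lemma poly_matvec_add_vec:
  "poly_matvec d A p (\<lambda>i. v i + w i) = (\<lambda>i. poly_matvec d A p v i + poly_matvec d A p w i)"
  by (induction p) (simp_all add: poly_matvec_pCons poly_matvec_0 matvec_add algebra_simps)

lemma poly_matvec_scale_vec: "poly_matvec d A p (\<lambda>i. c * v i) = (\<lambda>i. c * poly_matvec d A p v i)"
  by (induction p) (simp_all add: poly_matvec_pCons poly_matvec_0 matvec_scale algebra_simps)

text \<open>Coordinates from \<open>d\<close> on survive in the constant term
  \<open>a * v i\<close>, so identities between vectors are claimed only below
  \<open>d\<close>.\<close>

lemma poly_matvec_cong:
  assumes "\<forall>i<d. v i = w i"
  shows "\<forall>i<d. poly_matvec d A p v i = poly_matvec d A p w i"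
proof (induction p)
  case (pCons a p)
  then have "matvec d A (poly_matvec d A p v) = matvec d A (poly_matvec d A p w)"
    by (simp add: matvec_def)
  then show ?case using assms by (simp add: poly_matvec_pCons)
qed (simp add: poly_matvec_0)

lemma poly_matvec_expand:
  assumes "i < d"
  shows "poly_matvec d A p v i = (\<Sum>j<d. poly_matvec d A p (\<lambda>l. if l = j then 1 else 0) i * v j)"
proof -
  have *: "poly_matvec d A p (\<lambda>l. \<Sum>j\<in>S. v j * (if l = j then 1 else 0)) i
      = (\<Sum>j\<in>S. v j * poly_matvec d A p (\<lambda>l. if l = j then 1 else 0) i)" if "finite S" for S
    using that
  proof (induction S)
    case empty
    have "poly_matvec d A p (\<lambda>l. 0 * v l) i = 0" by (subst poly_matvec_scale_vec) simp
    then show ?case by simp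
  next
    case (insert k S)
    have "(\<lambda>l. \<Sum>j\<in>insert k S. v j * (if l = j then 1 else 0))
        = (\<lambda>l. v k * (if l = k then 1 else 0) + (\<Sum>j\<in>S. v j * (if l = j then 1 else 0)))"
      by (simp only: sum.insert[OF insert.hyps])
    then show ?case
      by (simp only: sum.insert[OF insert.hyps] insert.IH poly_matvec_add_vec poly_matvec_scale_vec)
  qed
  have "poly_matvec d A p v i = poly_matvec d A p (\<lambda>l. \<Sum>j<d. v j * (if l = j then 1 else 0)) i"
    using assms by (intro poly_matvec_cong[rule_format]) (auto simp: if_distrib sum.delta' cong: if_cong)
  then show ?thesis using *[of "{..<d}"] by (simp add: mult.commute)
qed

lemma poly_matvec_sum_coeffs:
  "poly_matvec d A p v i = (\<Sum>n\<le>degree p. coeff p n * poly_matvec d A (monom 1 n) v i)"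
proof -
  have "poly_matvec d A (\<Sum>n\<in>S. monom (coeff p n) n) v i
      = (\<Sum>n\<in>S. coeff p n * poly_matvec d A (monom 1 n) v i)" if "finite S" for S
    using that
  proof (induction S)
    case (insert n S)
    have "monom (coeff p n) n = smult (coeff p n) (monom 1 n)" by (simp add: smult_monom)
    with insert show ?case by (simp add: poly_matvec_add poly_matvec_smult)
  qed (simp add: poly_matvec_0)
  from this[of "{..degree p}"] show ?thesis by (simp add: poly_as_sum_of_monoms)
qed

text \<open>A dimension count: the \<open>d * d + 1\<close> powers of \<open>A\<close> with
  exponents up to \<open>d * d\<close> are linearly dependent, having only \<open>d * d\<close>
  entries each.\<close>

lemma annihilating_poly:
  "\<exists>q. q \<noteq> 0 \<and> (\<forall>v. \<forall>i<d. poly_matvec d A q v i = 0)"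
proof -
  define e where "e j = (\<lambda>l::nat. if l = j then 1 else (0::real))" for j :: nat
  have "\<exists>c. (\<exists>n\<in>{..d * d}. c n \<noteq> 0) \<and>
      (\<forall>ij\<in>{..<d} \<times> {..<d}. (\<Sum>n\<in>{..d * d}. poly_matvec d A (monom 1 n) (e (snd ij)) (fst ij) * c n) = 0)"
    by (rule homogeneous_system_nontrivial_solution) auto
  then obtain c where c1: "\<exists>n\<in>{..d * d}. c n \<noteq> 0" and c2:
    "\<forall>ij\<in>{..<d} \<times> {..<d}. (\<Sum>n\<in>{..d * d}. poly_matvec d A (monom 1 n) (e (snd ij)) (fst ij) * c n) = 0"
    by blast
  define q where "q = (\<Sum>n\<le>d * d. monom (c n) n)"
  have cq: "coeff q n = (if n \<le> d * d then c n else 0)" for n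
    by (simp add: q_def coeff_sum if_distrib cong: if_cong)
  have "q \<noteq> 0" using c1 cq by (metis coeff_0 atMost_iff)
  moreover have "poly_matvec d A q v i = 0" if "i < d" for v i
  proof -
    have "poly_matvec d A q (e j) i = 0" if "j < d" for j
    proof -
      have dq: "degree q \<le> d * d" by (rule degree_le) (simp add: cq)
      have "poly_matvec d A q (e j) i = (\<Sum>n\<le>degree q. coeff q n * poly_matvec d A (monom 1 n) (e j) i)"
        by (rule poly_matvec_sum_coeffs)
      also have "\<dots> = (\<Sum>n\<le>d * d. coeff q n * poly_matvec d A (monom 1 n) (e j) i)"
        using dq by (intro sum.mono_neutral_left) (auto simp: coeff_eq_0)
      also have "\<dots> = 0" using c2 \<open>i < d\<close> that by (simp add: cq mult.commute)
      finally show ?thesis .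
    qed
    then show ?thesis using poly_matvec_expand[OF \<open>i < d\<close>, of A q v] by (simp add: e_def)
  qed
  ultimately show ?thesis by blast
qed

section \<open>Self-adjointness and the spectrum of psd matrices\<close>

lemma psd_inner_matvec:
  assumes "psd d A"
  shows "inner_d d (matvec d A u) v = inner_d d u (matvec d A v)"
proof -
  have "inner_d d (matvec d A u) v = (\<Sum>i<d. \<Sum>j<d. A i j * u j * v i)"
    by (simp add: inner_d_def matvec_def sum_distrib_right)
  also have "\<dots> = (\<Sum>j<d. \<Sum>i<d. A i j * u j * v i)" by (rule sum.swap)
  also have "\<dots> = (\<Sum>j<d. \<Sum>i<d. u j * (A j i * v i))"
    using assms by (intro sum.cong refl) (auto simp: psd_def)
  finally show ?thesis by (simp add: inner_d_def matvec_def sum_distrib_left)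
qed

lemma psd_inner_poly_matvec:
  assumes "psd d A"
  shows "inner_d d (poly_matvec d A p u) v = inner_d d u (poly_matvec d A p v)"
proof -
  have "inner_d d v (poly_matvec d A p u) = inner_d d u (poly_matvec d A p v)" for u v
  proof (induction p arbitrary: u v)
    case 0
    show ?case by (simp add: poly_matvec_0 inner_d_zero_right)
  next
    case (pCons a p)
    \<comment> \<open>\<open>A\<close> commutes with \<open>p(A)\<close> because the polynomials
      \<open>[:0, 1:]\<close> and \<open>p\<close> commute.\<close>
    have comm: "matvec d A (poly_matvec d A p u) = poly_matvec d A p (matvec d A u)" for u
      using poly_matvec_mult[of d A "[:0, 1:]" p u] poly_matvec_mult[of d A p "[:0, 1:]" u]
      by (simp add: poly_matvec_X mult.commute)
    show ?case
      unfolding poly_matvec_pCons inner_d_add_right inner_d_scale_right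
      by (metis comm inner_d_commute pCons.IH psd_inner_matvec[OF assms])
  qed
  then show ?thesis by (metis inner_d_commute)
qed

text \<open>
  A psd matrix has only nonnegative eigenvalues and no nontrivial Jordan blocks: repeated factors, factors with
  negative roots and quadratic factors without real roots can be dropped from an annihilating polynomial.
\<close>

lemma psd_squarefree_annihilator:
  assumes A: "psd d A" and "q \<noteq> 0"
  shows "\<exists>L. finite L \<and> (\<forall>l\<in>L. 0 \<le> l) \<and>
    (\<forall>v. (\<forall>i<d. poly_matvec d A q v i = 0) \<longrightarrow> (\<forall>i<d. poly_matvec d A (\<Prod>l\<in>L. [:-l, 1:]) v i = 0))"
  using assms(2)
proof (induction "degree q" arbitrary: q rule: less_induct)
  case less
  show ?case
  proof (cases "degree q = 0")
    case True
    then obtain c where "q = [:c:]" "c \<noteq> 0" using less.prems by (metis degree_eq_zeroE pCons_0_0)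
    then show ?thesis
      by (intro exI[of _ "{}"]) (simp add: poly_matvec_pCons poly_matvec_0 matvec_zero poly_matvec_1)
  next
    case False
    then have "0 < degree q" by simp
    then show ?thesis
    proof (cases rule: real_poly_factor)
      case (quadratic a b r)
      define X where "X = [:-a, 1:]"
      have "r \<noteq> 0" using quadratic less.prems by auto
      have "degree (X\<^sup>2 + [:b\<^sup>2:]) = 2" by (simp add: X_def power2_eq_square)
      then have "degree q = 2 + degree r"
        unfolding quadratic X_def[symmetric] by (subst degree_mult_eq) (use \<open>r \<noteq> 0\<close> in auto)
      then obtain L where L: "finite L" "\<forall>l\<in>L. 0 \<le> l"
        "\<And>v. \<forall>i<d. poly_matvec d A r v i = 0 \<Longrightarrow> \<forall>i<d. poly_matvec d A (\<Prod>l\<in>L. [:-l, 1:]) v i = 0"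
        using less.hyps[of r] \<open>r \<noteq> 0\<close> by auto
      have "\<forall>i<d. poly_matvec d A r v i = 0" if z: "\<forall>i<d. poly_matvec d A q v i = 0" for v
      proof -
        define w where "w = poly_matvec d A r v"
        define u where "u = poly_matvec d A X w"
        have "poly_matvec d A q v = poly_matvec d A (X * X + [:b\<^sup>2:]) w"
          unfolding quadratic w_def X_def by (simp only: poly_matvec_mult power2_eq_square)
        also have "\<dots> = (\<lambda>i. poly_matvec d A X u i + b\<^sup>2 * w i)"
          by (simp add: poly_matvec_add poly_matvec_mult u_def poly_matvec_pCons poly_matvec_0 matvec_zero)
        finally have "inner_d d w (\<lambda>i. poly_matvec d A X u i + b\<^sup>2 * w i) = 0"
          using z by (intro inner_d_zero_right) simp
        then have "inner_d d u u + b\<^sup>2 * inner_d d w w = 0"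
          unfolding inner_d_add_right inner_d_scale_right u_def psd_inner_poly_matvec[OF A] .
        then have "b\<^sup>2 * inner_d d w w = 0"
          using inner_d_self_nonneg[of d u] inner_d_self_nonneg[of d w] zero_le_power2[of b]
          by (smt (verit) mult_nonneg_nonneg)
        then have "inner_d d w w = 0" using quadratic(1) by simp
        then show ?thesis by (simp add: inner_d_self_eq_0 w_def)
      qed
      then show ?thesis using L by (intro exI[of _ L] conjI allI impI) simp_all
    next
      case (linear l r)
      define X where "X = [:-l, 1:]"
      have "r \<noteq> 0" using linear less.prems by auto
      have "degree q = 1 + degree r"
        unfolding linear by (subst degree_mult_eq) (use \<open>r \<noteq> 0\<close> in auto)
      then obtain L where L: "finite L" "\<forall>l\<in>L. 0 \<le> l"
        "\<And>v. \<forall>i<d. poly_matvec d A r v i = 0 \<Longrightarrow> \<forall>i<d. poly_matvec d A (\<Prod>l\<in>L. [:-l, 1:]) v i = 0"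
        using less.hyps[of r] \<open>r \<noteq> 0\<close> by auto
      \<comment> \<open>\<open>q(A) v = 0\<close> says that \<open>r(A)\<close> kills
        \<open>(A - l) v\<close>. The induction hypothesis speaks of individual vectors, so it
        applies to this one.\<close>
      have XL: "\<forall>i<d. poly_matvec d A (X * (\<Prod>l\<in>L. [:-l, 1:])) v i = 0"
        if "\<forall>i<d. poly_matvec d A q v i = 0" for v
      proof -
        have "\<forall>i<d. poly_matvec d A r (poly_matvec d A X v) i = 0"
          using that by (simp only: linear X_def poly_matvec_mult[symmetric] mult.commute[of r])
        from L(3)[OF this] show ?thesis
          by (simp only: poly_matvec_mult[symmetric] mult.commute[of X])
      qed
      consider "l < 0" | "0 \<le> l" "l \<in> L" | "0 \<le> l" "l \<notin> L" by linarith
      then show ?thesis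
      proof cases
        case 1
        have "\<forall>i<d. poly_matvec d A (\<Prod>l\<in>L. [:-l, 1:]) v i = 0"
          if "\<forall>i<d. poly_matvec d A q v i = 0" for v
        proof -
          define w where "w = poly_matvec d A (\<Prod>l\<in>L. [:-l, 1:]) v"
          have "\<forall>i<d. poly_matvec d A X w i = 0"
            using XL[OF that] by (simp only: poly_matvec_mult w_def)
          \<comment> \<open>A nonzero \<open>w\<close> would be an eigenvector for the negative
            eigenvalue \<open>l\<close>, contradicting positive semidefiniteness.\<close>
          then have "inner_d d w (\<lambda>i. - l * w i + matvec d A w i) = 0"
            by (intro inner_d_zero_right) (simp add: X_def poly_matvec_X)
          then have "- l * inner_d d w w + inner_d d w (matvec d A w) = 0"
            by (simp only: inner_d_add_right inner_d_scale_right)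
          moreover have "0 \<le> inner_d d w (matvec d A w)" using A by (simp add: psd_def)
          moreover have "0 \<le> - l * inner_d d w w"
            using 1 inner_d_self_nonneg[of d w] by (simp add: mult_nonpos_nonneg)
          ultimately have "- l * inner_d d w w = 0" by linarith
          then have "inner_d d w w = 0" using 1 by simp
          then show ?thesis by (simp add: inner_d_self_eq_0 w_def)
        qed
        then show ?thesis using L(1,2) by (intro exI[of _ L] conjI allI impI) simp_all
      next
        case 2
        have "\<forall>i<d. poly_matvec d A (\<Prod>l\<in>L. [:-l, 1:]) v i = 0"
          if "\<forall>i<d. poly_matvec d A q v i = 0" for v
        proof -
          define w where "w = poly_matvec d A (\<Prod>l\<in>L - {l}. [:-l, 1:]) v"
          have pL: "(\<Prod>l\<in>L. [:-l, 1:]) = X * (\<Prod>l\<in>L - {l}. [:-l, 1:])"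
            unfolding X_def by (rule prod.remove) (use 2 L in auto)
          define u where "u = poly_matvec d A X w"
          have "\<forall>i<d. poly_matvec d A X u i = 0"
            using XL[OF that] by (simp only: poly_matvec_mult w_def u_def pL)
          \<comment> \<open>From \<open>(A - l)^2 w = 0\<close> follows
            \<open>|(A - l) w|^2 = 0\<close>, so a single factor suffices.\<close>
          then have "inner_d d w (poly_matvec d A X u) = 0" by (rule inner_d_zero_right)
          then have "inner_d d u u = 0"
            by (simp only: u_def psd_inner_poly_matvec[OF A])
          then show ?thesis by (simp add: inner_d_self_eq_0 u_def w_def pL poly_matvec_mult)
        qed
        then show ?thesis using L(1,2) by (intro exI[of _ L] conjI allI impI) simp_all
      next
        case 3
        then have "(\<Prod>l\<in>insert l L. [:-l, 1:]) = X * (\<Prod>l\<in>L. [:-l, 1:])"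
          unfolding X_def by (intro prod.insert) (use L in auto)
        then show ?thesis using 3 L(1,2) XL by (intro exI[of _ "insert l L"]) auto
      qed
    qed
  qed
qed

text \<open>The root is \<open>g(A)\<^sup>2\<close> with \<open>g(\<lambda>) = \<lambda>\<^bsup>1/4\<^esup>\<close> on the spectrum; being a square makes it psd.\<close>

lemma psd_sqrt_exists:
  assumes A: "psd d A"
  shows "\<exists>B. psd d B \<and> (\<forall>i<d. \<forall>j<d. (\<Sum>l<d. B i l * B l j) = A i j)"
proof -
  obtain q where "q \<noteq> 0" "\<forall>v. \<forall>i<d. poly_matvec d A q v i = 0" using annihilating_poly by blast
  then obtain L where L: "finite L" "\<forall>l\<in>L. 0 \<le> l"
    "\<And>v. \<forall>i<d. poly_matvec d A (\<Prod>l\<in>L. [:-l, 1:]) v i = 0"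
    using psd_squarefree_annihilator[OF A] by meson
  obtain g where g: "\<forall>l\<in>L. poly g l = sqrt (sqrt l)"
    using poly_interpolation[OF L(1), of "\<lambda>l. sqrt (sqrt l)"] by blast
  define f where "f = g * g"
  \<comment> \<open>\<open>f\<close> takes the value \<open>sqrt l\<close> at each \<open>l\<close>
    in \<open>L\<close>, so \<open>f * f\<close> and the identity polynomial agree there; modulo the
    annihilator this gives \<open>f(A)^2 = A\<close>.\<close>
  have "(\<Prod>l\<in>L. [:-l, 1:]) dvd f * f - [:0, 1:]"
    by (rule prod_linear_factors_dvd) (use L g in \<open>auto simp: f_def\<close>)
  then obtain h where h: "f * f = (\<Prod>l\<in>L. [:-l, 1:]) * h + [:0, 1:]"
    by (metis dvdE diff_add_cancel)
  have ff: "poly_matvec d A f (poly_matvec d A f v) i = matvec d A v i" if "i < d" for v i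
    using that L(3)[of "poly_matvec d A h v"]
    by (simp add: poly_matvec_mult[symmetric] h poly_matvec_add poly_matvec_X)
  define e where "e j = (\<lambda>l::nat. if l = j then 1 else (0::real))" for j :: nat
  define B where "B i j = poly_matvec d A f (e j) i" for i j
  have inner_e: "inner_d d (e i) v = v i" if "i < d" for i v
    using that by (simp add: inner_d_def e_def if_distrib[of "\<lambda>x. x * _"] cong: if_cong)
  have Bv: "matvec d B v i = poly_matvec d A f v i" if "i < d" for v i
    unfolding matvec_def B_def e_def using poly_matvec_expand[OF that, of A f v] by simp
  have "B i j = B j i" if "i < d" "j < d" for i j
    using psd_inner_poly_matvec[OF A, of f "e i" "e j"] that inner_d_commute
    by (metis B_def inner_e)
  moreover have "0 \<le> inner_d d v (matvec d B v)" for v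
  proof -
    have "inner_d d v (matvec d B v) = inner_d d v (poly_matvec d A f v)"
      unfolding inner_d_def using Bv by simp
    also have "\<dots> = inner_d d (poly_matvec d A g v) (poly_matvec d A g v)"
      by (simp add: f_def poly_matvec_mult psd_inner_poly_matvec[OF A])
    finally show ?thesis by (simp add: inner_d_self_nonneg)
  qed
  ultimately have "psd d B" by (simp add: psd_def)
  moreover have "(\<Sum>l<d. B i l * B l j) = A i j" if "i < d" "j < d" for i j
  proof -
    have "(\<Sum>l<d. B i l * B l j) = matvec d B (poly_matvec d A f (e j)) i"
      by (simp add: matvec_def B_def)
    also have "\<dots> = matvec d A (e j) i" using that by (simp add: Bv ff)
    also have "\<dots> = A i j"
      using that by (simp add: matvec_def e_def if_distrib cong: if_cong)
    finally show ?thesis .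
  qed
  ultimately show ?thesis by blast
qed

lemma psd_sqrt:
  assumes "psd d A"
  shows "psd d (psd_sqrt d A)"
    and "i < d \<Longrightarrow> j < d \<Longrightarrow> (\<Sum>l<d. psd_sqrt d A i l * psd_sqrt d A l j) = A i j"
  using someI_ex[OF psd_sqrt_exists[OF assms]] by (auto simp: psd_sqrt_def)

section \<open>Homogenised sum-of-squares certificates\<close>

lemma polyfun_deg_leI:
  assumes "finite J" "\<And>j. j \<in> J \<Longrightarrow> (\<Sum>i<d. \<alpha> j i) \<le> m"
    "\<And>v. f v = (\<Sum>j\<in>J. c j * (\<Prod>i<d. v i ^ (\<alpha> j i :: nat)))"
  shows "polyfun_deg_le d m f"
  unfolding polyfun_deg_le_def
proof (intro exI conjI allI)
  \<comment> \<open>\<open>polyfun_deg_le\<close> sums over a set of exponent vectors, so indices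
    with the same exponents are merged by adding their coefficients.\<close>
  define c' where "c' \<beta> = (\<Sum>j\<in>{j \<in> J. \<alpha> j = \<beta>}. c j)" for \<beta>
  fix v
  have "f v = (\<Sum>\<beta>\<in>\<alpha> ` J. \<Sum>j\<in>{j \<in> J. \<alpha> j = \<beta>}. c j * (\<Prod>i<d. v i ^ (\<alpha> j i :: nat)))"
    unfolding assms(3) using assms(1) by (rule sum.image_gen)
  also have "\<dots> = (\<Sum>\<beta>\<in>\<alpha> ` J. c' \<beta> * (\<Prod>i<d. v i ^ \<beta> i))"
    by (intro sum.cong refl) (auto simp: c'_def sum_distrib_right)
  finally show "f v = (\<Sum>\<beta>\<in>\<alpha> ` J. c' \<beta> * (\<Prod>i<d. v i ^ \<beta> i))" .
qed (use assms in auto)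

lemma polyfun_deg_le_const: "polyfun_deg_le d m (\<lambda>v. c)"
  by (rule polyfun_deg_leI[where J = "{()}" and \<alpha> = "\<lambda>_ _. 0" and c = "\<lambda>_. c"]) auto

lemma polyfun_deg_le_var:
  assumes "j < d"
  shows "polyfun_deg_le d 1 (\<lambda>v. v j)"
proof (rule polyfun_deg_leI[where J = "{()}" and \<alpha> = "\<lambda>_ i. if i = j then 1 else 0" and c = "\<lambda>_. 1"])
  show "v j = (\<Sum>u\<in>{()}. 1 * (\<Prod>i<d. v i ^ (if i = j then 1 else 0)))" for v :: "nat \<Rightarrow> real"
    using assms by (simp add: if_distrib prod.delta cong: if_cong)
qed (use assms in auto)

lemma polyfun_deg_le_mult:
  assumes "polyfun_deg_le d m f" "polyfun_deg_le d n g"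
  shows "polyfun_deg_le d (m + n) (\<lambda>v. f v * g v)"
proof -
  obtain A a where A: "finite A" "\<forall>\<alpha>\<in>A. (\<Sum>i<d. \<alpha> i) \<le> m"
    "\<And>v. f v = (\<Sum>\<alpha>\<in>A. a \<alpha> * (\<Prod>i<d. v i ^ \<alpha> i))"
    using assms(1) unfolding polyfun_deg_le_def by auto
  obtain B b where B: "finite B" "\<forall>\<beta>\<in>B. (\<Sum>i<d. \<beta> i) \<le> n"
    "\<And>v. g v = (\<Sum>\<beta>\<in>B. b \<beta> * (\<Prod>i<d. v i ^ \<beta> i))"
    using assms(2) unfolding polyfun_deg_le_def by auto
  show ?thesis
  proof (rule polyfun_deg_leI[where J = "A \<times> B" and \<alpha> = "\<lambda>p i. fst p i + snd p i"
        and c = "\<lambda>p. a (fst p) * b (snd p)"])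
    show "f v * g v = (\<Sum>p\<in>A \<times> B. a (fst p) * b (snd p) * (\<Prod>i<d. v i ^ (fst p i + snd p i)))" for v
      unfolding A(3) B(3) sum_product sum.cartesian_product
      by (intro sum.cong refl) (auto simp: power_add prod.distrib mult_ac)
  qed (use A B in \<open>auto simp: sum.distrib intro: add_mono\<close>)
qed

lemma polyfun_deg_le_add:
  assumes "polyfun_deg_le d m f" "polyfun_deg_le d m g"
  shows "polyfun_deg_le d m (\<lambda>v. f v + g v)"
proof -
  obtain A a where A: "finite A" "\<forall>\<alpha>\<in>A. (\<Sum>i<d. \<alpha> i) \<le> m"
    "\<And>v. f v = (\<Sum>\<alpha>\<in>A. a \<alpha> * (\<Prod>i<d. v i ^ \<alpha> i))"
    using assms(1) unfolding polyfun_deg_le_def by auto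
  obtain B b where B: "finite B" "\<forall>\<beta>\<in>B. (\<Sum>i<d. \<beta> i) \<le> m"
    "\<And>v. g v = (\<Sum>\<beta>\<in>B. b \<beta> * (\<Prod>i<d. v i ^ \<beta> i))"
    using assms(2) unfolding polyfun_deg_le_def by auto
  show ?thesis
  proof (rule polyfun_deg_leI[where J = "A <+> B" and \<alpha> = "case_sum id id" and c = "case_sum a b"])
    show "f v + g v = (\<Sum>j\<in>A <+> B. case_sum a b j * (\<Prod>i<d. v i ^ case_sum id id j i))" for v
      unfolding A(3) B(3) using A(1) B(1) by (simp add: sum.Plus)
  qed (use A B in auto)
qed

lemma polyfun_deg_le_sum:
  assumes "finite S" "\<And>j. j \<in> S \<Longrightarrow> polyfun_deg_le d m (f j)"
  shows "polyfun_deg_le d m (\<lambda>v. \<Sum>j\<in>S. f j v)"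
  using assms
  by (induction S) (simp_all add: polyfun_deg_le_const polyfun_deg_le_add)

lemma polyfun_deg_le_power:
  assumes "polyfun_deg_le d m f"
  shows "polyfun_deg_le d (m * n) (\<lambda>v. f v ^ n)"
proof (induction n)
  case (Suc n)
  then show ?case using polyfun_deg_le_mult[OF assms Suc.IH] by simp
qed (simp add: polyfun_deg_le_const)

lemma polyfun_deg_le_scale:
  assumes "polyfun_deg_le d m f"
  shows "polyfun_deg_le d m (\<lambda>v. c * f v)"
  using polyfun_deg_le_mult[OF polyfun_deg_le_const[of d 0 c] assms] by simp

lemma polyfun_deg_le_inner_d: "polyfun_deg_le d 1 (inner_d d x)"
  unfolding inner_d_def[abs_def]
  by (intro polyfun_deg_le_sum polyfun_deg_le_scale polyfun_deg_le_var) auto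

lemma polyfun_deg_le_matvec: "polyfun_deg_le d 1 (\<lambda>v. matvec d B v r)"
  unfolding matvec_def
  by (intro polyfun_deg_le_sum polyfun_deg_le_scale polyfun_deg_le_var) auto

lemma norm_d_squared: "(norm_d d v)\<^sup>2 = (\<Sum>i<d. (v i)\<^sup>2)"
  by (simp add: L2_set_def sum_nonneg)

text \<open>The norm is a square root, but its square is a quadratic polynomial. This is the origin
  of the parity conditions on the certificates.\<close>

lemma polyfun_deg_le_norm_d_even_power:
  assumes "even n"
  shows "polyfun_deg_le d n (\<lambda>v. norm_d d (matvec d B v) ^ n)"
proof -
  obtain k where n: "n = 2 * k" using assms by (rule evenE)
  have "polyfun_deg_le d (1 * 2) (\<lambda>v. (matvec d B v r)\<^sup>2)" for r
    by (intro polyfun_deg_le_power polyfun_deg_le_matvec)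
  then have "polyfun_deg_le d 2 (\<lambda>v. \<Sum>r<d. (matvec d B v r)\<^sup>2)"
    by (intro polyfun_deg_le_sum) auto
  then have "polyfun_deg_le d (2 * k) (\<lambda>v. (\<Sum>r<d. (matvec d B v r)\<^sup>2) ^ k)"
    by (rule polyfun_deg_le_power)
  then show ?thesis by (simp add: n power_mult norm_d_squared)
qed

section \<open>Closure properties of sums of squares\<close>

lemma sos_proof_nonneg_square:
  "polyfun_deg_le d k q \<Longrightarrow> sos_proof_nonneg d (2 * k) (\<lambda>v. (q v)\<^sup>2)"
  unfolding sos_proof_nonneg_def by (intro exI[of _ "[q]"]) simp

lemma sos_proof_nonneg_add:
  assumes "sos_proof_nonneg d n f" "sos_proof_nonneg d n g"
  shows "sos_proof_nonneg d n (\<lambda>v. f v + g v)"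
proof -
  obtain ps where "\<forall>q\<in>set ps. polyfun_deg_le d (n div 2) q" "\<forall>v. f v = (\<Sum>q\<leftarrow>ps. (q v)\<^sup>2)"
    using assms(1) unfolding sos_proof_nonneg_def by blast
  moreover obtain qs where "\<forall>q\<in>set qs. polyfun_deg_le d (n div 2) q" "\<forall>v. g v = (\<Sum>q\<leftarrow>qs. (q v)\<^sup>2)"
    using assms(2) unfolding sos_proof_nonneg_def by blast
  ultimately show ?thesis unfolding sos_proof_nonneg_def by (intro exI[of _ "ps @ qs"]) auto
qed

lemma sos_proof_nonneg_sum:
  assumes "finite S" "\<And>j. j \<in> S \<Longrightarrow> sos_proof_nonneg d n (f j)"
  shows "sos_proof_nonneg d n (\<lambda>v. \<Sum>j\<in>S. f j v)"
  using assms
proof (induction S)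
  case empty
  show ?case unfolding sos_proof_nonneg_def by (intro exI[of _ "[]"]) simp
qed (simp add: sos_proof_nonneg_add)

section \<open>Homogenisation of univariate polynomials\<close>

lemma homog_eval_add: "homog_eval k (p + q) s t = homog_eval k p s t + homog_eval k q s t"
  by (simp add: homog_eval_def distrib_right sum.distrib)

lemma homog_eval_diff: "homog_eval k (p - q) s t = homog_eval k p s t - homog_eval k q s t"
  by (simp add: homog_eval_def left_diff_distrib sum_subtractf)

lemma homog_eval_smult: "homog_eval k (smult c p) s t = c * homog_eval k p s t"
  by (simp add: homog_eval_def sum_distrib_left mult.assoc)

lemma homog_eval_monom: "n \<le> k \<Longrightarrow> homog_eval k (monom c n) s t = c * t ^ n * s ^ (k - n)"
  by (simp add: homog_eval_def if_distrib[of "\<lambda>x. x * _"] cong: if_cong)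

text \<open>Writing the argument as \<open>s * z\<close> avoids a division and includes
  \<open>s = 0\<close>, which occurs for \<open>v\<close> in the kernel of the covariance.\<close>

lemma homog_eval_scaled:
  assumes "degree p \<le> k"
  shows "homog_eval k p s (s * z) = s ^ k * poly p z"
proof -
  have pz: "poly p z = (\<Sum>i\<le>k. coeff p i * z ^ i)"
    unfolding poly_altdef using assms by (intro sum.mono_neutral_left) (auto simp: coeff_eq_0)
  have *: "coeff p i * (s * z) ^ i * s ^ (k - i) = s ^ k * (coeff p i * z ^ i)" if "i \<le> k" for i
  proof -
    have "s ^ k = s ^ i * s ^ (k - i)" using that by (simp add: power_add[symmetric])
    then show ?thesis by (simp add: power_mult_distrib)
  qed
  have "homog_eval k p s (s * z) = (\<Sum>i\<le>k. s ^ k * (coeff p i * z ^ i))"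
    unfolding homog_eval_def by (intro sum.cong refl *) simp
  then show ?thesis by (simp only: pz sum_distrib_left)
qed

lemma homog_eval_nonzero:
  assumes "degree p \<le> k" "s \<noteq> 0"
  shows "homog_eval k p s t = s ^ k * poly p (t / s)"
  using homog_eval_scaled[OF assms(1), of s "t / s"] assms(2) by simp

lemma continuous_homog_eval: "isCont (\<lambda>s. homog_eval k p s t) x"
  unfolding homog_eval_def by (intro continuous_intros)

text \<open>For \<open>s \<noteq> 0\<close> both sides are \<open>s ^ (k + l)\<close> times the
  value at \<open>t / s\<close>; the case \<open>s = 0\<close> follows by continuity in
  \<open>s\<close>.\<close>

lemma homog_eval_mult:
  assumes "degree p \<le> k" "degree q \<le> l"
  shows "homog_eval (k + l) (p * q) s t = homog_eval k p s t * homog_eval l q s t"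
proof -
  have deg: "degree (p * q) \<le> k + l" using degree_mult_le[of p q] assms by linarith
  have nz: "homog_eval (k + l) (p * q) s t = homog_eval k p s t * homog_eval l q s t" if "s \<noteq> 0" for s
    using that by (simp add: homog_eval_nonzero[OF deg] homog_eval_nonzero[OF assms(1)]
        homog_eval_nonzero[OF assms(2)] power_add)
  have "((\<lambda>s. homog_eval (k + l) (p * q) s t) \<longlongrightarrow> homog_eval (k + l) (p * q) 0 t) (at 0)"
    using continuous_homog_eval by (simp add: isCont_def)
  moreover have "((\<lambda>s. homog_eval (k + l) (p * q) s t) \<longlongrightarrow> homog_eval k p 0 t * homog_eval l q 0 t) (at 0)"
  proof (rule Lim_transform_eventually)
    show "((\<lambda>s. homog_eval k p s t * homog_eval l q s t) \<longlongrightarrow> homog_eval k p 0 t * homog_eval l q 0 t) (at 0)"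
      using continuous_homog_eval by (intro tendsto_mult) (simp_all add: isCont_def)
    show "\<forall>\<^sub>F s in at 0. homog_eval k p s t * homog_eval l q s t = homog_eval (k + l) (p * q) s t"
      using nz by (simp add: eventually_at_filter)
  qed
  ultimately show ?thesis using nz tendsto_unique[OF at_neq_bot] by (cases "s = 0") auto
qed

lemma homog_eval_square:
  "degree p \<le> k \<Longrightarrow> homog_eval (2 * k) (p\<^sup>2) s t = (homog_eval k p s t)\<^sup>2"
  using homog_eval_mult[of p k p k s t] by (simp add: power2_eq_square mult_2)

text \<open>Only even \<open>i\<close> contribute, and \<open>k\<close> is even, so the norm occurs
  only with even exponents \<open>k - i\<close> and the homogenisation is a polynomial in
  \<open>v\<close>.\<close>

lemma sos_homog_eval_square_even:
  assumes "even k" "\<And>n. odd n \<Longrightarrow> coeff g n = 0"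
  shows "sos_proof_nonneg d (2 * k) (\<lambda>v. (homog_eval k g (norm_d d (matvec d B v)) (inner_d d x v))\<^sup>2)"
proof (rule sos_proof_nonneg_square)
  have "polyfun_deg_le d k (\<lambda>v. coeff g i * inner_d d x v ^ i * norm_d d (matvec d B v) ^ (k - i))"
    if "i \<le> k" for i
  proof (cases "even i")
    case True
    have "polyfun_deg_le d (1 * i + (k - i))
        (\<lambda>v. (coeff g i * inner_d d x v ^ i) * norm_d d (matvec d B v) ^ (k - i))"
      by (intro polyfun_deg_le_mult polyfun_deg_le_scale polyfun_deg_le_power polyfun_deg_le_inner_d
          polyfun_deg_le_norm_d_even_power) (use assms(1) True in auto)
    then show ?thesis using that by simp
  qed (simp add: assms(2) polyfun_deg_le_const)
  then show "polyfun_deg_le d k (\<lambda>v. homog_eval k g (norm_d d (matvec d B v)) (inner_d d x v))"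
    unfolding homog_eval_def by (intro polyfun_deg_le_sum) auto
qed

text \<open>
  For odd \<open>g\<close> the homogenisation is \<open>\<parallel>B v\<parallel>\<close> times a polynomial in \<open>v\<close>, so its square is the sum over \<open>r\<close>
  of the squares of that polynomial times \<open>(B v)\<^sub>r\<close>.
\<close>

lemma sos_homog_eval_square_odd:
  assumes "even k" "\<And>n. even n \<Longrightarrow> coeff g n = 0"
  shows "sos_proof_nonneg d (2 * k) (\<lambda>v. (homog_eval k g (norm_d d (matvec d B v)) (inner_d d x v))\<^sup>2)"
proof (cases "k = 0")
  case True
  then show ?thesis
    using assms(2)[of 0] sos_proof_nonneg_square[OF polyfun_deg_le_const[of d 0 0]] by (simp add: homog_eval_def)
next
  case False
  \<comment> \<open>The top index \<open>k\<close> is even, so its coefficient vanishes and one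
    factor of the norm can be taken out; for odd \<open>i\<close> the remaining exponent
    \<open>k - 1 - i\<close> is even.\<close>
  define q where "q v = homog_eval (k - 1) g (norm_d d (matvec d B v)) (inner_d d x v)" for v
  have "polyfun_deg_le d (k - 1) (\<lambda>v. coeff g i * inner_d d x v ^ i * norm_d d (matvec d B v) ^ (k - 1 - i))"
    if "i \<le> k - 1" for i
  proof (cases "odd i")
    case True
    have "polyfun_deg_le d (1 * i + (k - 1 - i))
        (\<lambda>v. (coeff g i * inner_d d x v ^ i) * norm_d d (matvec d B v) ^ (k - 1 - i))"
      by (intro polyfun_deg_le_mult polyfun_deg_le_scale polyfun_deg_le_power polyfun_deg_le_inner_d
          polyfun_deg_le_norm_d_even_power) (use assms(1) True False in auto)
    moreover have "1 * i + (k - 1 - i) = k - 1" using that by simp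
    ultimately show ?thesis by (simp only:)
  qed (simp add: assms(2) polyfun_deg_le_const)
  then have q: "polyfun_deg_le d (k - 1) q"
    unfolding q_def homog_eval_def by (intro polyfun_deg_le_sum) auto
  have "homog_eval k g s t = s * homog_eval (k - 1) g s t" for s t
  proof -
    have "{..k} = insert k {..k - 1}" using False by auto
    then have "homog_eval k g s t = (\<Sum>i\<le>k - 1. coeff g i * t ^ i * s ^ (k - i))"
      using False assms by (simp add: homog_eval_def)
    also have "\<dots> = (\<Sum>i\<le>k - 1. s * (coeff g i * t ^ i * s ^ (k - 1 - i)))"
    proof (intro sum.cong refl)
      fix i assume "i \<in> {..k - 1}"
      then have "k - i = Suc (k - 1 - i)" using False by auto
      then show "coeff g i * t ^ i * s ^ (k - i) = s * (coeff g i * t ^ i * s ^ (k - 1 - i))"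
        by simp
    qed
    finally show ?thesis by (simp only: homog_eval_def sum_distrib_left)
  qed
  then have "(homog_eval k g (norm_d d (matvec d B v)) (inner_d d x v))\<^sup>2
      = (\<Sum>r<d. (matvec d B v r * q v)\<^sup>2)" for v
    by (simp add: power_mult_distrib norm_d_squared q_def sum_distrib_right)
  moreover have "sos_proof_nonneg d (2 * k) (\<lambda>v. \<Sum>r<d. (matvec d B v r * q v)\<^sup>2)"
    using False polyfun_deg_le_mult[OF polyfun_deg_le_matvec q]
    by (intro sos_proof_nonneg_sum sos_proof_nonneg_square) auto
  ultimately show ?thesis by simp
qed

text \<open>Averaging \<open>F(t)\<close> and \<open>F(-t)\<close> cancels the cross terms of the
  even and odd parts of \<open>g\<close> and \<open>h\<close>. So \<open>F\<close> is a sum of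
  squares of even and odd polynomials, whose homogenisations are already handled.\<close>

lemma sos_homog_eval_even_nonneg:
  assumes "even k" "degree F \<le> 2 * k" and odd: "\<And>n. odd n \<Longrightarrow> coeff F n = 0"
    and "\<And>t. 0 \<le> poly F t"
  shows "sos_proof_nonneg d (2 * k) (\<lambda>v. homog_eval (2 * k) F (norm_d d (matvec d B v)) (inner_d d x v))"
proof -
  obtain g h where F: "F = g\<^sup>2 + h\<^sup>2" using nonneg_poly_sum_two_squares assms(4) by blast
  have deg: "degree g \<le> k" "degree h \<le> k" using degree_le_of_sum_two_squares[of g h k] assms(2) F by simp_all
  define R :: "real poly \<Rightarrow> real poly" where "R f = f \<circ>\<^sub>p [:0, -1:]" for f
  define e where "e f = smult (1/2) (f + R f)" for f
  define o' where "o' f = smult (1/2) (f - R f)" for f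
  have cR: "coeff (R f) n = (-1) ^ n * coeff f n" for f n
    by (simp add: R_def coeff_pcompose_linear)
  have dR: "degree (R f) = degree f" for f by (simp add: R_def degree_pcompose)
  have pR: "poly (R f) t = poly f (- t)" for f t by (simp add: R_def poly_pcompose)
  have "R F = F"
    by (rule poly_eqI) (use odd in \<open>auto simp: cR minus_one_power_iff\<close>)
  then have sym: "poly F (- t) = poly F t" for t using pR[of F t] by simp
  have "poly F t = poly ((e g)\<^sup>2 + (o' g)\<^sup>2 + ((e h)\<^sup>2 + (o' h)\<^sup>2)) t" for t
  proof -
    have "poly F t = (poly F t + poly F (- t)) / 2" by (simp add: sym)
    also have "\<dots> = poly ((e g)\<^sup>2 + (o' g)\<^sup>2 + ((e h)\<^sup>2 + (o' h)\<^sup>2)) t"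
      by (simp add: F e_def o'_def pR power2_eq_square field_simps)
    finally show ?thesis .
  qed
  then have F': "F = (e g)\<^sup>2 + (o' g)\<^sup>2 + ((e h)\<^sup>2 + (o' h)\<^sup>2)"
    by (metis poly_eq_poly_eq_iff ext)
  have dg: "degree (e f) \<le> k" "degree (o' f) \<le> k" if "degree f \<le> k" for f
    using that dR[of f] by (auto simp: e_def o'_def intro: degree_add_le degree_diff_le)
  have "homog_eval (2 * k) F s t = (homog_eval k (e g) s t)\<^sup>2 + (homog_eval k (o' g) s t)\<^sup>2
      + ((homog_eval k (e h) s t)\<^sup>2 + (homog_eval k (o' h) s t)\<^sup>2)" for s t
    using dg[OF deg(1)] dg[OF deg(2)] by (subst F') (simp add: homog_eval_add homog_eval_square)
  moreover have "coeff (e f) n = 0" if "odd n" for f n using that by (simp add: e_def cR)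
  moreover have "coeff (o' f) n = 0" if "even n" for f n using that by (simp add: o'_def cR)
  ultimately show ?thesis
    using assms(1)
    by (simp add: sos_proof_nonneg_add sos_homog_eval_square_even sos_homog_eval_square_odd)
qed

section \<open>Linear forms of Gaussian vectors\<close>

abbreviation std_gaussian :: "nat \<Rightarrow> (nat \<Rightarrow> real) measure" where
  "std_gaussian d \<equiv> \<Pi>\<^sub>M i\<in>{..<d}. std_normal_distribution"

lemma prob_space_std_normal: "prob_space std_normal_distribution"
  by (rule prob_space_normal_density) simp

lemma prob_space_std_gaussian: "prob_space (std_gaussian d)"
  by (intro prob_space_PiM prob_space_std_normal)

lemma sets_std_gaussian: "sets (std_gaussian d) = sets (Rd d)"
  by (rule sets_PiM_cong) auto

lemma measurable_std_gaussian_component: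
  "i < d \<Longrightarrow> (\<lambda>g. g i) \<in> borel_measurable (std_gaussian d)"
  using measurable_component_singleton[of i "{..<d}" "\<lambda>_. std_normal_distribution"]
  by (simp add: measurable_def)

lemma distr_std_gaussian_component:
  assumes "i < d"
  shows "distr (std_gaussian d) borel (\<lambda>g. g i) = std_normal_distribution"
proof -
  have "distr (std_gaussian d) borel (\<lambda>g. g i) = distr (std_gaussian d) std_normal_distribution (\<lambda>g. g i)"
    by (rule distr_cong) auto
  also have "\<dots> = std_normal_distribution"
    by (rule distr_PiM_component) (use assms prob_space_std_normal in auto)
  finally show ?thesis .
qed

lemma indep_vars_std_gaussian:
  assumes "0 < d"
  shows "prob_space.indep_vars (std_gaussian d) (\<lambda>_. borel) (\<lambda>i g. g i) {..<d}"
proof -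
  interpret prob_space "std_gaussian d" by (rule prob_space_std_gaussian)
  have "distr (std_gaussian d) (Rd d) (\<lambda>g. \<lambda>i\<in>{..<d}. g i) = distr (std_gaussian d) (std_gaussian d) (\<lambda>g. g)"
    by (rule distr_cong) (auto simp: sets_std_gaussian space_PiM PiE_restrict)
  also have "\<dots> = std_gaussian d" by simp
  also have "\<dots> = (\<Pi>\<^sub>M i\<in>{..<d}. distr (std_gaussian d) borel (\<lambda>g. g i))"
    by (rule PiM_cong) (auto simp: distr_std_gaussian_component)
  finally show ?thesis
    using assms by (subst indep_vars_iff_distr_eq_PiM') (auto simp: measurable_std_gaussian_component)
qed

lemma distributed_std_gaussian_linear:
  assumes "0 < norm_d d w"
  shows "distributed (std_gaussian d) lborel (\<lambda>g. \<Sum>i<d. g i * w i) (normal_density 0 (norm_d d w))"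
proof -
  interpret prob_space "std_gaussian d" by (rule prob_space_std_gaussian)
  \<comment> \<open>Summands with \<open>w i = 0\<close> are constant and have no normal density, so
    they are left out before independent normals are added.\<close>
  define I where "I = {i. i < d \<and> w i \<noteq> 0}"
  have I: "finite I" "I \<subseteq> {..<d}" by (auto simp: I_def)
  have "I \<noteq> {}"
  proof
    assume "I = {}"
    then have "norm_d d w = 0" by (auto simp: I_def L2_set_eq_0_iff)
    then show False using assms by simp
  qed
  then have "0 < d" by (auto simp: I_def)
  then have "indep_vars (\<lambda>_. borel) (\<lambda>i g. g i * w i) I"
    by (intro indep_vars_compose2[OF indep_vars_subset[OF indep_vars_std_gaussian I(2)]]) auto
  moreover have "distributed (std_gaussian d) lborel (\<lambda>g. g i * w i) (normal_density 0 \<bar>w i\<bar>)"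
    if "i \<in> I" for i
  proof -
    have i: "i < d" "w i \<noteq> 0" using that by (auto simp: I_def)
    have "distr (std_gaussian d) lborel (\<lambda>g. g i) = distr (std_gaussian d) borel (\<lambda>g. g i)"
      by (rule distr_cong) auto
    then have "distributed (std_gaussian d) lborel (\<lambda>g. g i) std_normal_density"
      using i by (simp add: distributed_def distr_std_gaussian_component measurable_std_gaussian_component)
    from normal_density_affine[OF this, of "w i" 0] show ?thesis using i by (simp add: mult.commute)
  qed
  ultimately have "distributed (std_gaussian d) lborel (\<lambda>g. \<Sum>i\<in>I. g i * w i)
      (normal_density (\<Sum>i\<in>I. 0) (sqrt (\<Sum>i\<in>I. \<bar>w i\<bar>\<^sup>2)))"
    using I \<open>I \<noteq> {}\<close> by (intro sum_indep_normal) (auto simp: I_def)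
  moreover have "(\<Sum>i\<in>I. g i * w i) = (\<Sum>i<d. g i * w i)" for g
    by (rule sum.mono_neutral_left) (auto simp: I_def)
  moreover have "(\<Sum>i\<in>I. \<bar>w i\<bar>\<^sup>2) = (\<Sum>i<d. (w i)\<^sup>2)"
    unfolding power2_abs by (rule sum.mono_neutral_left) (auto simp: I_def)
  ultimately show ?thesis by (simp add: L2_set_def)
qed

text \<open>If \<open>w\<close> vanishes below \<open>d\<close>, both laws are the point mass at 0,
  which has no density; otherwise both have the centred normal density with deviation
  \<open>norm_d d w\<close>.\<close>

lemma distr_std_gaussian_linear:
  "distr (std_gaussian d) borel (\<lambda>g. \<Sum>i<d. g i * w i)
    = distr std_normal_distribution borel (\<lambda>z. norm_d d w * z)"
proof (cases "norm_d d w = 0")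
  case True
  then have "\<forall>i<d. w i = 0" by (auto simp: L2_set_eq_0_iff)
  then have "(\<lambda>g. \<Sum>i<d. g i * w i) = (\<lambda>g. 0)" by auto
  then show ?thesis
    using True prob_space.distr_const[OF prob_space_std_gaussian, of "0::real" borel d]
      prob_space.distr_const[OF prob_space_std_normal, of "0::real" borel] by simp
next
  case False
  then have pos: "0 < norm_d d w" using L2_set_nonneg[of w "{..<d}"] by linarith
  interpret N: prob_space std_normal_distribution by (rule prob_space_std_normal)
  have "distr std_normal_distribution lborel (\<lambda>z. z) = std_normal_distribution"
    by (rule distr_id2) simp
  then have "distributed std_normal_distribution lborel (\<lambda>z. z) std_normal_density"
    by (simp add: distributed_def)
  from N.normal_density_affine[OF this, of "norm_d d w" 0] pos
  have "distributed std_normal_distribution lborel (\<lambda>z. norm_d d w * z) (normal_density 0 (norm_d d w))"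
    by simp
  then have "distr (std_gaussian d) lborel (\<lambda>g. \<Sum>i<d. g i * w i)
      = distr std_normal_distribution lborel (\<lambda>z. norm_d d w * z)"
    using distributed_std_gaussian_linear[OF pos] by (simp add: distributed_def)
  moreover have "distr M lborel f = distr M borel f" for M :: "'x measure" and f :: "'x \<Rightarrow> real"
    by (rule distr_cong) auto
  ultimately show ?thesis by metis
qed

section \<open>The law \<open>gaussian d \<Sigma>\<close>, its mean and its covariance\<close>

lemma measurable_matvec:
  "(\<lambda>g. restrict (matvec d B g) {..<d}) \<in> measurable (std_gaussian d) (Rd d)"
  unfolding matvec_def
  by (intro measurable_restrict borel_measurable_sum borel_measurable_times
      measurable_std_gaussian_component borel_measurable_const) auto

lemma prob_space_gaussian: "prob_space (gaussian d \<Sigma>)"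
  unfolding gaussian_def
  by (rule prob_space.prob_space_distr[OF prob_space_std_gaussian measurable_matvec])

lemma sets_gaussian: "sets (gaussian d \<Sigma>) = sets (Rd d)"
  by (simp add: gaussian_def)

lemma measurable_inner_d: "(\<lambda>x. inner_d d x v) \<in> borel_measurable (Rd d)"
  unfolding inner_d_def by measurable

text \<open>The root \<open>B\<close> is symmetric, so the inner product of \<open>B g\<close> and
  \<open>v\<close> is the linear form of \<open>g\<close> with coefficients \<open>B v\<close>.
  Every moment needed is thereby reduced to one standard normal variable.\<close>

lemma distr_gaussian_inner_d:
  assumes "psd d \<Sigma>"
  shows "distr (gaussian d \<Sigma>) borel (\<lambda>x. inner_d d x v)
    = distr std_normal_distribution borel (\<lambda>z. norm_d d (matvec d (psd_sqrt d \<Sigma>) v) * z)"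
proof -
  define B where "B = psd_sqrt d \<Sigma>"
  have B: "psd d B" unfolding B_def by (rule psd_sqrt[OF assms])
  have "distr (gaussian d \<Sigma>) borel (\<lambda>x. inner_d d x v)
      = distr (std_gaussian d) borel ((\<lambda>x. inner_d d x v) \<circ> (\<lambda>g. restrict (matvec d B g) {..<d}))"
    unfolding gaussian_def B_def by (rule distr_distr[OF measurable_inner_d measurable_matvec])
  also have "(\<lambda>x. inner_d d x v) \<circ> (\<lambda>g. restrict (matvec d B g) {..<d})
      = (\<lambda>g. \<Sum>i<d. g i * matvec d B v i)"
    using psd_inner_matvec[OF B] by (auto simp: inner_d_def)
  finally show ?thesis unfolding distr_std_gaussian_linear B_def .
qed

lemma
  fixes f :: "real \<Rightarrow> real"
  assumes \<Sigma>: "psd d \<Sigma>" and f: "f \<in> borel_measurable borel"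
  shows integrable_gaussian_inner_d: "integrable (gaussian d \<Sigma>) (\<lambda>x. f (inner_d d x v))
      \<longleftrightarrow> integrable std_normal_distribution (\<lambda>z. f (norm_d d (matvec d (psd_sqrt d \<Sigma>) v) * z))"
    and integral_gaussian_inner_d: "(LINT x|gaussian d \<Sigma>. f (inner_d d x v))
      = (LINT z|std_normal_distribution. f (norm_d d (matvec d (psd_sqrt d \<Sigma>) v) * z))"
proof -
  define s where "s = norm_d d (matvec d (psd_sqrt d \<Sigma>) v)"
  have m1: "(\<lambda>x. inner_d d x v) \<in> borel_measurable (gaussian d \<Sigma>)"
    using measurable_inner_d[of d v] by (simp add: gaussian_def)
  have m2: "(\<lambda>z. s * z) \<in> borel_measurable std_normal_distribution" by simp
  note eq = distr_gaussian_inner_d[OF \<Sigma>, of v, folded s_def]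
  show "integrable (gaussian d \<Sigma>) (\<lambda>x. f (inner_d d x v))
      \<longleftrightarrow> integrable std_normal_distribution (\<lambda>z. f (norm_d d (matvec d (psd_sqrt d \<Sigma>) v) * z))"
    unfolding s_def[symmetric] integrable_distr_eq[OF m1 f, symmetric] integrable_distr_eq[OF m2 f, symmetric] eq ..
  show "(LINT x|gaussian d \<Sigma>. f (inner_d d x v))
      = (LINT z|std_normal_distribution. f (norm_d d (matvec d (psd_sqrt d \<Sigma>) v) * z))"
    unfolding s_def[symmetric] integral_distr[OF m1 f, symmetric] integral_distr[OF m2 f, symmetric] eq ..
qed

lemma zero_mean_gaussian:
  assumes "psd d \<Sigma>"
  shows "zero_mean d (gaussian d \<Sigma>)"
  unfolding zero_mean_def
proof (intro allI impI conjI)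
  fix i assume "i < d"
  define e where "e = (\<lambda>l::nat. if l = i then 1 else (0::real))"
  have e: "inner_d d x e = x i" for x
    using \<open>i < d\<close> by (simp add: inner_d_def e_def if_distrib cong: if_cong)
  show "integrable (gaussian d \<Sigma>) (\<lambda>x. x i)"
    using integrable_gaussian_inner_d[OF assms, of "\<lambda>y. y" e] integrable_std_normal_distribution_moment[of 1]
    by (simp add: e)
  show "(LINT x|gaussian d \<Sigma>. x i) = 0"
    using integral_gaussian_inner_d[OF assms, of "\<lambda>y. y" e] integral_std_normal_distribution_moment_odd[of 1]
    by (simp add: e)
qed

lemma norm_d_psd_sqrt_squared:
  assumes "psd d \<Sigma>"
  shows "(norm_d d (matvec d (psd_sqrt d \<Sigma>) v))\<^sup>2 = inner_d d v (matvec d \<Sigma> v)"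
proof -
  define B where "B = psd_sqrt d \<Sigma>"
  have B: "psd d B" unfolding B_def by (rule psd_sqrt[OF assms])
  have "matvec d B (matvec d B v) i = matvec d \<Sigma> v i" if "i < d" for i
  proof -
    have "matvec d B (matvec d B v) i = (\<Sum>l<d. \<Sum>j<d. B i l * B l j * v j)"
      by (simp add: matvec_def sum_distrib_left mult.assoc)
    also have "\<dots> = (\<Sum>j<d. \<Sum>l<d. B i l * B l j * v j)" by (rule sum.swap)
    also have "\<dots> = (\<Sum>j<d. \<Sigma> i j * v j)"
      using psd_sqrt(2)[OF assms that] by (simp add: sum_distrib_right[symmetric] B_def)
    finally show ?thesis by (simp add: matvec_def)
  qed
  then have "inner_d d v (matvec d \<Sigma> v) = inner_d d v (matvec d B (matvec d B v))"
    by (simp add: inner_d_def)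
  also have "\<dots> = inner_d d (matvec d B v) (matvec d B v)" by (simp add: psd_inner_matvec[OF B])
  finally show ?thesis unfolding norm_d_squared by (simp add: inner_d_def power2_eq_square B_def)
qed

lemma
  assumes "psd d \<Sigma>"
  shows integrable_gaussian_inner_d_squared: "integrable (gaussian d \<Sigma>) (\<lambda>x. (inner_d d x v)\<^sup>2)"
    and integral_gaussian_inner_d_squared:
      "(LINT x|gaussian d \<Sigma>. (inner_d d x v)\<^sup>2) = inner_d d v (matvec d \<Sigma> v)"
  using integrable_gaussian_inner_d[OF assms, of "\<lambda>y. y\<^sup>2" v]
    integral_gaussian_inner_d[OF assms, of "\<lambda>y. y\<^sup>2" v]
    integrable_std_normal_distribution_moment[of 2] std_normal_distribution_even_moments(1)[of 1]
    norm_d_psd_sqrt_squared[OF assms, of v]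
  by (simp_all add: power_mult_distrib)

lemma has_covariance_gaussian:
  assumes \<Sigma>: "psd d \<Sigma>"
  shows "has_covariance d (gaussian d \<Sigma>) \<Sigma>"
proof -
  let ?D = "gaussian d \<Sigma>"
  have "integrable ?D (\<lambda>x. x i * x j) \<and> (LINT x|?D. x i * x j) = \<Sigma> i j" if ij: "i < d" "j < d" for i j
  proof -
    define e where "e n = (\<lambda>l::nat. if l = n then 1 else (0::real))" for n
    define u where "u = (\<lambda>l. e i l + e j l)"
    have e: "inner_d d x (e n) = x n" if "n < d" for x n
      using that by (simp add: inner_d_def e_def if_distrib cong: if_cong)
    \<comment> \<open>Polarisation: the mixed moment is obtained from second moments of linear
      forms.\<close>
    have prod: "x i * x j = ((inner_d d x u)\<^sup>2 - (inner_d d x (e i))\<^sup>2 - (inner_d d x (e j))\<^sup>2) / 2" for x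
      unfolding u_def inner_d_add_right by (simp add: e ij power2_eq_square algebra_simps)
    have "integrable ?D (\<lambda>x. x i * x j) \<and> (LINT x|?D. x i * x j)
        = (inner_d d u (matvec d \<Sigma> u) - inner_d d (e i) (matvec d \<Sigma> (e i))
           - inner_d d (e j) (matvec d \<Sigma> (e j))) / 2"
      unfolding prod
      by (simp add: integrable_gaussian_inner_d_squared[OF \<Sigma>] integral_gaussian_inner_d_squared[OF \<Sigma>])
    moreover have "inner_d d u (matvec d \<Sigma> u) = inner_d d (e i) (matvec d \<Sigma> (e i))
        + inner_d d (e j) (matvec d \<Sigma> (e j)) + 2 * inner_d d (e i) (matvec d \<Sigma> (e j))"
      unfolding u_def matvec_add inner_d_add_right inner_d_add_left
      using psd_inner_matvec[OF \<Sigma>, of "e i" "e j"] inner_d_commute[of d "matvec d \<Sigma> (e i)" "e j"]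
      by simp
    moreover have "inner_d d (e i) (matvec d \<Sigma> (e j)) = matvec d \<Sigma> (e j) i"
      by (metis e ij(1) inner_d_commute)
    moreover have "matvec d \<Sigma> (e j) i = \<Sigma> i j"
      using ij by (simp add: matvec_def e_def if_distrib cong: if_cong)
    ultimately show ?thesis by simp
  qed
  moreover have "(LINT x|?D. x i) = 0" if "i < d" for i
    using zero_mean_gaussian[OF \<Sigma>] that by (simp add: zero_mean_def)
  ultimately show ?thesis by (simp add: has_covariance_def)
qed

section \<open>Anti-concentration certificates\<close>

lemma
  fixes v :: "nat \<Rightarrow> real"
  assumes \<Sigma>: "psd d \<Sigma>"
  defines "s \<equiv> norm_d d (matvec d (psd_sqrt d \<Sigma>) v)"
  shows integrable_gaussian_hermite_kernel: "integrable (gaussian d \<Sigma>)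
      (\<lambda>x. (homog_eval (2 * m) (hermite_kernel m) (s) (inner_d d x v))\<^sup>2)"
    and integral_gaussian_hermite_kernel: "(LINT x|gaussian d \<Sigma>.
      (homog_eval (2 * m) (hermite_kernel m) (s) (inner_d d x v))\<^sup>2)
      = (s ^ (2 * m))\<^sup>2 * (fact m / pochhammer (1/2) (Suc m) / 2)"
proof -
  have f: "(\<lambda>y. (homog_eval (2 * m) (hermite_kernel m) (s) y)\<^sup>2) \<in> borel_measurable borel"
    unfolding homog_eval_def by measurable
  have eq: "(homog_eval (2 * m) (hermite_kernel m) (s) (s * z))\<^sup>2
      = (s ^ (2 * m))\<^sup>2 * (poly (hermite_kernel m) z)\<^sup>2" for z
    by (simp only: homog_eval_scaled[OF degree_hermite_kernel] power_mult_distrib)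
  have [measurable]: "(\<lambda>z. (poly (hermite_kernel m) z)\<^sup>2) \<in> borel_measurable borel"
    unfolding poly_hermite_kernel by measurable
  have int: "integrable std_normal_distribution (\<lambda>z. (poly (hermite_kernel m) z)\<^sup>2)"
    "(LINT z|std_normal_distribution. (poly (hermite_kernel m) z)\<^sup>2) = fact m / pochhammer (1/2) (Suc m) / 2"
    using hermite_kernel_second_moment[of m]
    by (simp_all add: integrable_density integral_density has_bochner_integral_iff)
  show "integrable (gaussian d \<Sigma>)
      (\<lambda>x. (homog_eval (2 * m) (hermite_kernel m) (s) (inner_d d x v))\<^sup>2)"
    using int(1) unfolding integrable_gaussian_inner_d[OF \<Sigma> f] s_def[symmetric] eq
    by (rule integrable_mult_right)
  show "(LINT x|gaussian d \<Sigma>. (homog_eval (2 * m) (hermite_kernel m) (s) (inner_d d x v))\<^sup>2)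
      = (s ^ (2 * m))\<^sup>2 * (fact m / pochhammer (1/2) (Suc m) / 2)"
    unfolding integral_gaussian_inner_d[OF \<Sigma> f] s_def[symmetric] eq
    by (simp only: integral_mult_right_zero int(2))
qed

text \<open>The lower bound on \<open>m\<close> makes the second moment at most
  \<open>\<delta>\<close>; the upper bound makes the kernel at least \<open>1/2\<close> on
  \<open>|t| \<le> \<delta>/2\<close>. The kernel has degree at most \<open>k = 2 * m\<close>, so
  the certificates have degree \<open>4 * m\<close>.\<close>

lemma certifiably_anti_concentrated_gaussian:
  assumes \<Sigma>: "psd d \<Sigma>" and \<delta>: "0 < \<delta>" and m: "1 \<le> m" "1 \<le> real m * \<delta>\<^sup>2" "real m * \<delta>\<^sup>2 \<le> 6"
  shows "certifiably_anti_concentrated d (4 * m) 1 \<delta> (gaussian d \<Sigma>)"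
proof -
  define k where "k = 2 * m"
  define p where "p = hermite_kernel m"
  define s where "s v = norm_d d (matvec d (psd_sqrt d \<Sigma>) v)" for v
  have k: "even k" "1 \<le> k" "2 \<le> 2 * k" "4 * m = 2 * k" using m(1) by (auto simp: k_def)
  have p: "degree p \<le> k" unfolding p_def k_def by (rule degree_hermite_kernel)
  have sos1: "sos_proof_ge d (2 * k)
      (\<lambda>v. s v ^ (2 * k - 2) * (inner_d d x v)\<^sup>2 + \<delta>\<^sup>2 * (homog_eval k p (s v) (inner_d d x v))\<^sup>2)
      (\<lambda>v. \<delta>\<^sup>2 * s v ^ (2 * k) / 4)" for x
  proof -
    \<comment> \<open>Homogenising \<open>F\<close> in degree \<open>2 * k\<close> gives exactly the
      difference of the two sides, for every \<open>v\<close>.\<close>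
    define F where "F = monom 1 2 + smult (\<delta>\<^sup>2) (p\<^sup>2) - monom (\<delta>\<^sup>2 / 4) 0"
    have degp2: "degree (p\<^sup>2) \<le> 2 * k" using degree_power_le[of p 2] p by simp
    have "degree F \<le> 2 * k"
      unfolding F_def using k(3) degp2
      by (intro degree_diff_le degree_add_le) (auto simp: degree_monom_eq monom_0 intro: order.trans[OF degree_smult_le])
    moreover have "coeff F n = 0" if "odd n" for n
    proof -
      have "coeff (p\<^sup>2) n = 0"
        unfolding power2_eq_square coeff_mult
      proof (intro sum.neutral ballI)
        fix i assume "i \<in> {..n}"
        then have "odd i \<or> odd (n - i)" using that by auto
        then show "coeff p i * coeff p (n - i) = 0"
          using coeff_hermite_kernel_odd[of i m] coeff_hermite_kernel_odd[of "n - i" m] unfolding p_def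
          by (elim disjE) simp_all
      qed
      moreover have "n \<noteq> 2" "n \<noteq> 0" using that by (auto simp: odd_pos)
      ultimately show ?thesis by (simp add: F_def)
    qed
    moreover have "0 \<le> poly F t" for t
    proof -
      have Ft: "poly F t = t\<^sup>2 + \<delta>\<^sup>2 * (poly p t)\<^sup>2 - \<delta>\<^sup>2 / 4" by (simp add: F_def poly_monom)
      show ?thesis
      \<comment> \<open>Near 0 the kernel term alone reaches \<open>\<delta>^2 / 4\<close>;
        elsewhere \<open>t^2\<close> does.\<close>
      proof (cases "t\<^sup>2 \<le> \<delta>\<^sup>2 / 4")
        case True
        then have "real m * t\<^sup>2 \<le> real m * (\<delta>\<^sup>2 / 4)" by (intro mult_left_mono) auto
        then have "real m * t\<^sup>2 \<le> 3/2" using m(3) by simp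
        then have "1/2 \<le> poly p t" unfolding p_def using m(1) by (intro hermite_kernel_ge_half)
        then have "(1/2)\<^sup>2 \<le> (poly p t)\<^sup>2" by (intro power_mono) auto
        then have "\<delta>\<^sup>2 * (1/2)\<^sup>2 \<le> \<delta>\<^sup>2 * (poly p t)\<^sup>2" by (intro mult_left_mono) auto
        then have "\<delta>\<^sup>2 / 4 \<le> \<delta>\<^sup>2 * (poly p t)\<^sup>2" by (simp add: power_divide)
        then show ?thesis unfolding Ft using zero_le_power2[of t] by linarith
      next
        case False
        moreover have "0 \<le> \<delta>\<^sup>2 * (poly p t)\<^sup>2" by simp
        ultimately show ?thesis unfolding Ft by linarith
      qed
    qed
    ultimately have "sos_proof_nonneg d (2 * k) (\<lambda>v. homog_eval (2 * k) F (s v) (inner_d d x v))"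
      unfolding s_def using k(1) by (intro sos_homog_eval_even_nonneg)
    moreover have "homog_eval (2 * k) F (s v) t
        = s v ^ (2 * k - 2) * t\<^sup>2 + \<delta>\<^sup>2 * (homog_eval k p (s v) t)\<^sup>2 - \<delta>\<^sup>2 * s v ^ (2 * k) / 4" for v t
      unfolding F_def homog_eval_add homog_eval_diff homog_eval_smult homog_eval_square[OF p]
        homog_eval_monom[OF k(3)] homog_eval_monom[OF le0] by (simp add: mult.commute)
    ultimately show ?thesis by (simp add: sos_proof_ge_def)
  qed
  define c where "c = (fact m / pochhammer (1/2) (Suc m) / 2 :: real)"
  have "c\<^sup>2 \<le> 1 / (real m + 1)" unfolding c_def by (rule fact_div_pochhammer_half_le)
  also have "\<dots> \<le> \<delta>\<^sup>2"
  proof -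
    have "1 \<le> \<delta>\<^sup>2 * (real m + 1)" using m(2) by (simp add: algebra_simps add_increasing)
    then show ?thesis by (simp add: divide_le_eq)
  qed
  finally have "c \<le> \<delta>" using power2_le_imp_le[of c \<delta>] \<delta> by simp
  have int: "(LINT x|gaussian d \<Sigma>. (homog_eval k p (s v) (inner_d d x v))\<^sup>2) = (s v ^ k)\<^sup>2 * c" for v
    unfolding k_def p_def s_def c_def by (rule integral_gaussian_hermite_kernel[OF \<Sigma>])
  \<comment> \<open>The slack \<open>(\<delta> - c) * s v ^ (2 * k)\<close> is a single square, and
    \<open>s v ^ k\<close> is a polynomial because \<open>k\<close> is even.\<close>
  have "polyfun_deg_le d k (\<lambda>v. sqrt (\<delta> - c) * s v ^ k)"
    unfolding s_def using k(1) by (intro polyfun_deg_le_scale polyfun_deg_le_norm_d_even_power)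
  then have "sos_proof_nonneg d (2 * k) (\<lambda>v. (sqrt (\<delta> - c) * s v ^ k)\<^sup>2)"
    by (rule sos_proof_nonneg_square)
  moreover have "(sqrt (\<delta> - c) * s v ^ k)\<^sup>2 = 1 * \<delta> * s v ^ (2 * k) - (s v ^ k)\<^sup>2 * c" for v
  proof -
    have "s v ^ (2 * k) = (s v ^ k)\<^sup>2" by (simp add: power_mult[symmetric] mult.commute)
    then show ?thesis using \<open>c \<le> \<delta>\<close> by (simp add: power_mult_distrib algebra_simps)
  qed
  ultimately have sos2: "sos_proof_ge d (2 * k) (\<lambda>v. 1 * \<delta> * s v ^ (2 * k))
      (\<lambda>v. LINT x|gaussian d \<Sigma>. (homog_eval k p (s v) (inner_d d x v))\<^sup>2)"
    unfolding sos_proof_ge_def int by simp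
  have integrable: "integrable (gaussian d \<Sigma>) (\<lambda>x. (homog_eval k p (s v) (inner_d d x v))\<^sup>2)" for v
    unfolding k_def p_def s_def by (rule integrable_gaussian_hermite_kernel[OF \<Sigma>])
  show ?thesis
    unfolding certifiably_anti_concentrated_def
    by (intro conjI exI[of _ k] exI[of _ \<Sigma>] exI[of _ p] ballI allI prob_space_gaussian sets_gaussian
        zero_mean_gaussian[OF \<Sigma>] has_covariance_gaussian[OF \<Sigma>] k(2,4) p
        sos1[unfolded s_def] sos2[unfolded s_def] integrable[unfolded s_def])
qed

theorem theorem6p2:
  shows "\<exists>C>0. \<exists>K>0. \<forall>\<delta>::real. 0 < \<delta> \<and> \<delta> \<le> 1/2 \<longrightarrow>
    (\<exists>k::nat. real k \<le> K * (ln (1/\<delta>) ^ 5 / \<delta>\<^sup>2) \<and>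
      (\<forall>d \<Sigma>. psd d \<Sigma> \<longrightarrow> certifiably_anti_concentrated d k C \<delta> (gaussian d \<Sigma>)))"
\<comment> \<open>The degree \<open>4 * m\<close> is at most \<open>5 / \<delta>^2\<close>, and
  \<open>ln (1/\<delta>) \<ge> ln 2\<close> for \<open>\<delta> \<le> 1/2\<close>; dividing by
  \<open>ln 2 ^ 5\<close> absorbs the logarithmic factor.\<close>
proof (rule exI[of _ 1], rule conjI[OF zero_less_one], rule exI[of _ "5 / ln 2 ^ 5"], intro conjI allI impI)
  fix \<delta> :: real
  assume \<delta>: "0 < \<delta> \<and> \<delta> \<le> 1/2"
  \<comment> \<open>Rounding up gives
    \<open>1 \<le> m * \<delta>^2 \<le> 1 + \<delta>^2 \<le> 5/4\<close>, within the range from 1 to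
    6 required above.\<close>
  define m where "m = nat \<lceil>1 / \<delta>\<^sup>2\<rceil>"
  have pos: "0 < \<delta>\<^sup>2" using \<delta> by simp
  have sq: "\<delta>\<^sup>2 \<le> (1/2)\<^sup>2" using \<delta> by (intro power_mono) auto
  have m: "1 / \<delta>\<^sup>2 \<le> real m" "real m \<le> 1 / \<delta>\<^sup>2 + 1"
    unfolding m_def using pos by (auto simp: of_nat_ceiling le_of_int_ceiling)
  have "1 \<le> real m * \<delta>\<^sup>2" using m(1) pos by (simp add: field_simps)
  moreover have m\<delta>: "real m * \<delta>\<^sup>2 \<le> 1 + \<delta>\<^sup>2"
    using mult_right_mono[OF m(2), of "\<delta>\<^sup>2"] pos by (simp add: distrib_right)
  moreover have "1 + \<delta>\<^sup>2 \<le> 5/4" using sq by (simp add: power2_eq_square)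
  moreover have "1 \<le> m"
    using \<open>1 \<le> real m * \<delta>\<^sup>2\<close> by (cases m) auto
  ultimately have "certifiably_anti_concentrated d (4 * m) 1 \<delta> (gaussian d \<Sigma>)" if "psd d \<Sigma>" for d \<Sigma>
    using certifiably_anti_concentrated_gaussian[OF that, of \<delta> m] \<delta> by linarith
  moreover have "real (4 * m) \<le> 5 / ln 2 ^ 5 * (ln (1 / \<delta>) ^ 5 / \<delta>\<^sup>2)"
  proof -
    have "4 * (real m * \<delta>\<^sup>2) \<le> 5" using m\<delta> \<open>1 + \<delta>\<^sup>2 \<le> 5/4\<close> by linarith
    then have "real (4 * m) \<le> 5 / \<delta>\<^sup>2" using pos by (simp add: field_simps)
    also have "\<dots> = 5 / ln 2 ^ 5 * (ln 2 ^ 5 / \<delta>\<^sup>2)" by simp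
    also have "\<dots> \<le> 5 / ln 2 ^ 5 * (ln (1 / \<delta>) ^ 5 / \<delta>\<^sup>2)"
    proof (intro mult_left_mono divide_right_mono power_mono)
      show "ln 2 \<le> ln (1 / \<delta>)" using \<delta> by (intro ln_mono) (auto simp: field_simps)
    qed auto
    finally show ?thesis .
  qed
  ultimately show "\<exists>k::nat. real k \<le> 5 / ln 2 ^ 5 * (ln (1/\<delta>) ^ 5 / \<delta>\<^sup>2) \<and>
      (\<forall>d \<Sigma>. psd d \<Sigma> \<longrightarrow> certifiably_anti_concentrated d k 1 \<delta> (gaussian d \<Sigma>))"
    by blast
qed auto

end
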